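(* For open shop systems in which each job requires processing on at most two machines (i.e. $|\mathcal{M}(J)|\le 2$ for every job $J$), the problem Reachable Deadlock — decide whether the system can reach a deadlock state starting from the initial state $0$ — can be solved in polynomial time.
   Context: An open shop system consists of $n$ jobs $J_1,\ldots,J_n$ and $m$ machines $M_1,\ldots,M_m$. Each job $J_j$ has a set $\mathcal{M}(J_j)\subseteq\{M_1,\ldots,M_m\}$ of machines on which it must be processed, in an arbitrary order; each machine $M_i$ has a positive integer capacity $\mathrm{cap}(M_i)$. There are two artificial machines $M_0$ and $M_{m+1}$ of unbounded capacity. A state $s$ specifies for every job $J_j$ a machine $M^s(J_j)\in\{M_0,\ldots,M_{m+1}\}$ on which it currently sits and a set $\mathcal{M}^s(J_j)\subseteq\mathcal{M}(J_j)\setminus\{M^s(J_j)\}$ of machines on which it still needs processing; each machine $M_i$, $1\le i\le m$, holds at most $\mathrm{cap}(M_i)$ jobs. The initial state $0$ has $M^0(J_j)=M_0$, $\mathcal{M}^0(J_j)=\mathcal{M}(J_j)$; the final state $f$ has $M^f(J_j)=M_{m+1}$, $\mathcal{M}^f(J_j)=\emptyset$ for all $j$. A successor of $s$ arises by moving a single job $J_j$ from $M^s(J_j)$ to a machine $M\in\mathcal{M}^s(J_j)$ holding fewer than $\mathrm{cap}(M)$ jobs (removing $M$ from its remaining set), or by moving a job with $\mathcal{M}^s(J_j)=\emptyset$, $M^s(J_j)\ne M_{m+1}$ to $M_{m+1}$. A deadlock is a state other than $f$ with no successor. Reaching means via finitely many successor steps. *)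

theory Defs
  imports "HOL-Library.Log_Nat" "HOL-Computational_Algebra.Polynomial"
begin

section \<open>Open shop systems\<close>

text \<open>
  Jobs are \<open>1, \<dots>, njobs S\<close> and machines are \<open>1, \<dots>, nmach S\<close>; the numbers \<open>0\<close> and
  \<open>nmach S + 1\<close> are the two artificial machines of unbounded capacity. The values of \<open>cap\<close>
  and \<open>req\<close> outside these ranges are irrelevant.
\<close>

record open_shop =
  nmach :: nat
  njobs :: nat
  cap :: "nat \<Rightarrow> nat"
  req :: "nat \<Rightarrow> nat set"

definition machines :: "open_shop \<Rightarrow> nat set" where
  "machines S = {1..nmach S}"

definition jobs :: "open_shop \<Rightarrow> nat set" where
  "jobs S = {1..njobs S}"

definition well_formed :: "open_shop \<Rightarrow> bool" where
  "well_formed S \<longleftrightarrow>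
     (\<forall>i\<in>machines S. 0 < cap S i) \<and> (\<forall>j\<in>jobs S. req S j \<subseteq> machines S)"

record state =
  location :: "nat \<Rightarrow> nat"
  remaining :: "nat \<Rightarrow> nat set"

definition load :: "open_shop \<Rightarrow> state \<Rightarrow> nat \<Rightarrow> nat" where
  "load S s i = card {j \<in> jobs S. location s j = i}"

definition is_state :: "open_shop \<Rightarrow> state \<Rightarrow> bool" where
  "is_state S s \<longleftrightarrow>
     (\<forall>j\<in>jobs S. location s j \<in> {0..nmach S + 1} \<and>
                 remaining s j \<subseteq> req S j - {location s j}) \<and>
     (\<forall>i\<in>machines S. load S s i \<le> cap S i)"

definition initial_state :: "open_shop \<Rightarrow> state" where
  "initial_state S = \<lparr>location = (\<lambda>_. 0), remaining = req S\<rparr>"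

text \<open>
  A predicate rather than a single record, because states are only meaningful on \<open>jobs S\<close>.
\<close>

definition is_final :: "open_shop \<Rightarrow> state \<Rightarrow> bool" where
  "is_final S s \<longleftrightarrow> (\<forall>j\<in>jobs S. location s j = nmach S + 1 \<and> remaining s j = {})"

inductive successor :: "open_shop \<Rightarrow> state \<Rightarrow> state \<Rightarrow> bool" for S where
  to_machine:
    "\<lbrakk>j \<in> jobs S; i \<in> remaining s j; load S s i < cap S i\<rbrakk> \<Longrightarrow>
     successor S s \<lparr>location = (location s)(j := i),
                    remaining = (remaining s)(j := remaining s j - {i})\<rparr>"
| to_exit:
    "\<lbrakk>j \<in> jobs S; remaining s j = {}; location s j \<noteq> nmach S + 1\<rbrakk> \<Longrightarrow>
     successor S s \<lparr>location = (location s)(j := nmach S + 1), remaining = remaining s\<rparr>"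

definition deadlock :: "open_shop \<Rightarrow> state \<Rightarrow> bool" where
  "deadlock S s \<longleftrightarrow> is_state S s \<and> \<not> is_final S s \<and> \<not> (\<exists>t. successor S s t)"

definition reachable_deadlock :: "open_shop \<Rightarrow> bool" where
  "reachable_deadlock S \<longleftrightarrow>
     (\<exists>s. (successor S)\<^sup>*\<^sup>* (initial_state S) s \<and> deadlock S s)"

section \<open>Polynomial time\<close>

text \<open>
  The machine model is the random access machine of Cook and Reckhow (Time bounded random
  access machines, JCSS 1973): integer registers, addition and subtraction but no
  multiplication, a sequential input tape of integers, and logarithmic cost. Polynomial time on
  this model coincides with polynomial time on Turing machines. For decision problems, printing
  is replaced by two halting instructions.
\<close>

datatype instr =
    Const nat int        \<comment> \<open>\<open>X\<^sub>i \<leftarrow> C\<close>\<close>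
  | Add nat nat nat      \<comment> \<open>\<open>X\<^sub>i \<leftarrow> X\<^sub>j + X\<^sub>k\<close>\<close>
  | Sub nat nat nat      \<comment> \<open>\<open>X\<^sub>i \<leftarrow> X\<^sub>j - X\<^sub>k\<close>\<close>
  | Load nat nat         \<comment> \<open>\<open>X\<^sub>i \<leftarrow> X\<^bsub>X\<^sub>j\<^esub>\<close>\<close>
  | Store nat nat        \<comment> \<open>\<open>X\<^bsub>X\<^sub>i\<^esub> \<leftarrow> X\<^sub>j\<close>\<close>
  | Jump_pos nat nat     \<comment> \<open>jump to instruction \<open>l\<close> if \<open>X\<^sub>j > 0\<close>\<close>
  | Read nat
  | Accept
  | Reject

type_synonym program = "instr list"

record config =
  pc :: nat
  regs :: "nat \<Rightarrow> int"
  input :: "int list"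

definition int_size :: "int \<Rightarrow> nat" where
  "int_size x = 1 + floorlog 2 (nat \<bar>x\<bar>)"

definition input_size :: "int list \<Rightarrow> nat" where
  "input_size xs = (\<Sum>x\<leftarrow>xs. int_size x)"

definition start :: "int list \<Rightarrow> config" where
  "start xs = \<lparr>pc = 0, regs = (\<lambda>_. 0), input = xs\<rparr>"

definition assign :: "nat \<Rightarrow> int \<Rightarrow> config \<Rightarrow> config" where
  "assign i x c = c\<lparr>pc := Suc (pc c), regs := (regs c)(i := x)\<rparr>"

text \<open>
  \<open>exec ins c\<close> is the successor configuration together with the cost of the instruction. A
  negative address or a read past the end of the input gets the machine stuck, without an answer.
\<close>

fun exec :: "instr \<Rightarrow> config \<Rightarrow> (config \<times> nat) option" where
  "exec (Const i x) c = Some (assign i x c, 1)"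
| "exec (Add i j k) c =
     Some (assign i (regs c j + regs c k) c, int_size (regs c j) + int_size (regs c k))"
| "exec (Sub i j k) c =
     Some (assign i (regs c j - regs c k) c, int_size (regs c j) + int_size (regs c k))"
| "exec (Load i j) c =
     (if regs c j < 0 then None
      else Some (assign i (regs c (nat (regs c j))) c,
                 int_size (regs c j) + int_size (regs c (nat (regs c j)))))"
| "exec (Store i j) c =
     (if regs c i < 0 then None
      else Some (assign (nat (regs c i)) (regs c j) c,
                 int_size (regs c i) + int_size (regs c j)))"
| "exec (Jump_pos l j) c =
     Some (c\<lparr>pc := (if regs c j > 0 then l else Suc (pc c))\<rparr>, int_size (regs c j))"
| "exec (Read i) c =
     (case input c of
        [] \<Rightarrow> None
      | x # xs \<Rightarrow> Some ((assign i x c)\<lparr>input := xs\<rparr>, int_size x))"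
| "exec Accept c = None"
| "exec Reject c = None"

text \<open>
  \<open>halts P c t b\<close>: started in configuration \<open>c\<close>, program \<open>P\<close> halts with answer \<open>b\<close> at total
  cost \<open>t\<close>.
\<close>

inductive halts :: "program \<Rightarrow> config \<Rightarrow> nat \<Rightarrow> bool \<Rightarrow> bool" for P where
  accept: "\<lbrakk>pc c < length P; P ! pc c = Accept\<rbrakk> \<Longrightarrow> halts P c 1 True"
| reject: "\<lbrakk>pc c < length P; P ! pc c = Reject\<rbrakk> \<Longrightarrow> halts P c 1 False"
| step: "\<lbrakk>pc c < length P; exec (P ! pc c) c = Some (c', k); halts P c' t b\<rbrakk> \<Longrightarrow>
         halts P c (k + t) b"

lemma halts_deterministic:
  "halts P c t b \<Longrightarrow> halts P c t' b' \<Longrightarrow> t = t' \<and> b = b'"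
proof (induction arbitrary: t' b' rule: halts.induct)
  case (accept c)
  from accept(3,1,2) show ?case by cases auto
next
  case (reject c)
  from reject(3,1,2) show ?case by cases auto
next
  case (step c c' k t b)
  from step.prems show ?case
  proof cases
    case accept
    with step.hyps(2) show ?thesis by simp
  next
    case reject
    with step.hyps(2) show ?thesis by simp
  next
    case (step d l u)
    with \<open>exec (P ! pc c) c = Some (c', k)\<close> have "d = c'" "l = k" by simp_all
    with step \<open>\<And>t' b'. halts P c' t' b' \<Longrightarrow> t = t' \<and> b = b'\<close> show ?thesis by blast
  qed
qed

text \<open>
  \<open>A\<close> is the class of instances, \<open>enc\<close> their encoding as input, and \<open>Q\<close> the question.
\<close>

definition polynomial_time_solvable ::
    "('a \<Rightarrow> int list) \<Rightarrow> 'a set \<Rightarrow> ('a \<Rightarrow> bool) \<Rightarrow> bool" where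
  "polynomial_time_solvable enc A Q \<longleftrightarrow>
     (\<exists>(P :: program) (p :: nat poly).
        \<forall>x\<in>A. \<exists>t \<le> poly p (input_size (enc x)). halts P (start (enc x)) t (Q x))"

text \<open>
  An open shop system is written down as the numbers of machines and jobs, the capacities, and
  for every job the number of its machines followed by these machines in increasing order. All
  numbers count with their binary length, so that capacities may be exponential in the input size.
\<close>

definition encode :: "open_shop \<Rightarrow> int list" where
  "encode S =
     [int (nmach S), int (njobs S)] @
     map (\<lambda>i. int (cap S i)) [1..<Suc (nmach S)] @
     concat (map (\<lambda>j. int (card (req S j)) # map int (sorted_list_of_set (req S j)))
               [1..<Suc (njobs S)])"

end

theory Submission
  imports Defs
begin

text \<open>
  The jobs with two machines are the edges of a multigraph on the machines. In a deadlock, the full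
  machines form a nonempty set \<open>B\<close> that contains both ends of every edge (job) sitting in it, so the
  number of edges inside \<open>B\<close> is at least the total capacity of \<open>B\<close>. Conversely, a minimal nonempty \<open>B\<close>
  with this property satisfies Hall's condition, so all machines of \<open>B\<close> can be filled with jobs whose
  other machine is in \<open>B\<close>; these jobs never move again, and every maximal continuation is a deadlock.

  To find out whether such a set exists, split every edge into \<open>K = n\<^sup>2\<close> units and distribute them
  over its two ends; the slack of a machine is \<open>K\<close> times its capacity minus its number of units. As
  long as some unit sits on a machine whose slack is smaller by at least 2 than at the other end of
  its edge, move it there; this decreases the sum of the squared slacks. Capacities may be truncated
  at the number of jobs plus one, so this sum is polynomial at the beginning. If in the end all slacks
  are positive, every nonempty set contains fewer edges than its capacity. Otherwise one of the slack
  values \<open>1, \<dots>, n\<close> is not taken; the machines below it carry exactly all units of the edges inside and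
  have total slack less than \<open>n\<^sup>2 = K\<close>, so by integrality the edges inside reach the capacity.
\<close>

section \<open>Deadlocks and overcrowded sets of machines\<close>

text \<open>Shrink the sets \<open>N e\<close> while the counting condition survives. Once each has
  at most one element, the condition for singletons \<open>X\<close> is the claim. An
  \<open>M e\<close> with at most one element encodes a partial choice.\<close>

lemma hall_orientation:
  fixes N :: "'e \<Rightarrow> 'v set" and c :: "'v \<Rightarrow> nat"
  assumes "finite E" "finite B" "\<And>e. e \<in> E \<Longrightarrow> finite (N e)"
    and "\<And>X. X \<subseteq> B \<Longrightarrow> sum c X \<le> card {e \<in> E. N e \<inter> X \<noteq> {}}"
  shows "\<exists>M. (\<forall>e\<in>E. M e \<subseteq> N e \<and> card (M e) \<le> 1) \<and> (\<forall>i\<in>B. c i \<le> card {e \<in> E. i \<in> M e})"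
  using assms(3,4)
proof (induction "\<Sum>e\<in>E. card (N e)" arbitrary: N rule: less_induct)
  case less
  show ?case
  proof (cases "\<forall>e\<in>E. card (N e) \<le> 1")
    case True
    have "c i \<le> card {e \<in> E. i \<in> N e}" if "i \<in> B" for i
      using less.prems(2)[of "{i}"] that by simp
    with True show ?thesis by blast
  next
    case False
    then obtain e where e: "e \<in> E" "\<not> card (N e) \<le> 1" by blast
    then obtain a b where ab: "a \<in> N e" "b \<in> N e" "a \<noteq> b"
      using less.prems(1)[OF e(1)] by (metis card_le_Suc0_iff_eq One_nat_def)
    have step: ?thesis
      if v: "v \<in> N e" and H: "\<And>X. X \<subseteq> B \<Longrightarrow> sum c X \<le> card {f \<in> E. (N(e := N e - {v})) f \<inter> X \<noteq> {}}" for v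
    proof -
      let ?N = "N(e := N e - {v})"
      have lt: "(\<Sum>f\<in>E. card (?N f)) < (\<Sum>f\<in>E. card (N f))"
      proof (rule sum_strict_mono_ex1[OF assms(1)])
        show "\<forall>f\<in>E. card (?N f) \<le> card (N f)"
          using less.prems(1) by (auto simp: card_mono)
        show "\<exists>f\<in>E. card (?N f) < card (N f)"
          using e(1) v less.prems(1)[OF e(1)] by (intro bexI[of _ e]) (simp_all only: fun_upd_same card_Diff1_less)
      qed
      have fin: "finite (?N f)" if "f \<in> E" for f using less.prems(1) e(1) that by simp
      obtain M where M: "\<forall>f\<in>E. M f \<subseteq> ?N f \<and> card (M f) \<le> 1"
        "\<forall>i\<in>B. c i \<le> card {f \<in> E. i \<in> M f}"
        using less.hyps[OF lt fin H] by blast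
      moreover have "?N f \<subseteq> N f" for f by auto
      ultimately show ?thesis by (meson subset_trans)
    qed
    \<comment> \<open>If neither \<open>a\<close> nor \<open>b\<close> can be removed from \<open>N e\<close>, there are tight sets for both, and submodularity
      is violated by one, since \<open>e\<close> meets both of them but not their intersection.\<close>
    have tight: "\<exists>X\<subseteq>B. N e \<inter> X = {v} \<and> card {f \<in> E. N f \<inter> X \<noteq> {}} \<le> sum c X"
      if v: "v \<in> N e" and no: "\<not> ?thesis" for v
    proof -
      have "\<not> (\<forall>X\<subseteq>B. sum c X \<le> card {f \<in> E. (N(e := N e - {v})) f \<inter> X \<noteq> {}})"
        using step[OF v] no by blast
      then obtain X where X: "X \<subseteq> B" "card {f \<in> E. (N(e := N e - {v})) f \<inter> X \<noteq> {}} < sum c X"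
        unfolding not_le[symmetric] by blast
      let ?L = "{f \<in> E. N f \<inter> X \<noteq> {}}" and ?L' = "{f \<in> E. (N(e := N e - {v})) f \<inter> X \<noteq> {}}"
      \<comment> \<open>Only \<open>e\<close> can drop out of the count when \<open>v\<close> is
        deleted. Since \<open>X\<close> meets the condition before and violates it afterwards,
        \<open>e\<close> does drop out, and the count was exactly the demand of
        \<open>X\<close>.\<close>
      have sub: "?L \<subseteq> insert e ?L'" by auto
      have fin: "finite ?L'" using assms(1) by simp
      have "e \<notin> ?L'"
      proof
        assume "e \<in> ?L'"
        then have "?L \<subseteq> ?L'" using sub by auto
        then have "card ?L \<le> card ?L'" using fin by (rule card_mono[rotated])
        then show False using X less.prems(2)[OF X(1)] by simp
      qed
      have "e \<in> ?L"
      proof (rule ccontr)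
        assume "e \<notin> ?L"
        then have "?L \<subseteq> ?L'" using sub by auto
        then have "card ?L \<le> card ?L'" using fin by (rule card_mono[rotated])
        then show False using X less.prems(2)[OF X(1)] by simp
      qed
      have "card ?L \<le> Suc (card ?L')"
        using card_mono[OF _ sub] fin \<open>e \<notin> ?L'\<close> by simp
      then have "card ?L \<le> sum c X" using X by simp
      moreover have "N e \<inter> X = {v}" using \<open>e \<notin> ?L'\<close> \<open>e \<in> ?L\<close> by auto
      ultimately show ?thesis using X(1) by blast
    qed
    show ?thesis
    proof (rule ccontr)
      assume no: "\<not> ?thesis"
      obtain X where X: "X \<subseteq> B" "N e \<inter> X = {a}" "card {f \<in> E. N f \<inter> X \<noteq> {}} \<le> sum c X"
        using tight[OF ab(1) no] by blast
      obtain Y where Y: "Y \<subseteq> B" "N e \<inter> Y = {b}" "card {f \<in> E. N f \<inter> Y \<noteq> {}} \<le> sum c Y"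
        using tight[OF ab(2) no] by blast
      let ?L = "\<lambda>X. {f \<in> E. N f \<inter> X \<noteq> {}}"
      have fin: "finite (?L Z)" for Z using assms(1) by simp
      have disj: "e \<notin> ?L (X \<inter> Y)" using X(2) Y(2) ab(3) by auto
      have "insert e (?L (X \<inter> Y)) \<subseteq> ?L X \<inter> ?L Y" using X(2) Y(2) e(1) by auto
      then have "card (insert e (?L (X \<inter> Y))) \<le> card (?L X \<inter> ?L Y)"
        by (rule card_mono[rotated]) (use fin in blast)
      then have "Suc (card (?L (X \<inter> Y))) \<le> card (?L X \<inter> ?L Y)"
        by (simp only: card_insert_disjoint[OF fin disj])
      moreover have "?L X \<union> ?L Y = ?L (X \<union> Y)" by auto
      then have "card (?L X) + card (?L Y) = card (?L (X \<union> Y)) + card (?L X \<inter> ?L Y)"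
        using card_Un_Int[OF fin[of X] fin[of Y]] by simp
      moreover have "sum c (X \<union> Y) + sum c (X \<inter> Y) = sum c X + sum c Y"
        using X(1) Y(1) assms(2) by (intro sum.union_inter) (auto intro: finite_subset)
      moreover have "sum c (X \<union> Y) \<le> card (?L (X \<union> Y))" "sum c (X \<inter> Y) \<le> card (?L (X \<inter> Y))"
        using X(1) Y(1) by (auto intro!: less.prems(2))
      ultimately show False using X(3) Y(3) by linarith
    qed
  qed
qed

section \<open>Overcrowded sets and the distribution of their jobs\<close>

definition two_jobs :: "open_shop \<Rightarrow> nat set \<Rightarrow> nat set" where
  "two_jobs S B = {j \<in> jobs S. card (req S j) = 2 \<and> req S j \<subseteq> B}"

definition overcrowded :: "open_shop \<Rightarrow> nat set \<Rightarrow> bool" where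
  "overcrowded S B \<longleftrightarrow> B \<subseteq> machines S \<and> B \<noteq> {} \<and> sum (cap S) B \<le> card (two_jobs S B)"

lemma finite_jobs [simp]: "finite (jobs S)"
  by (simp add: jobs_def)

lemma finite_machines [simp]: "finite (machines S)"
  by (simp add: machines_def)

lemma finite_two_jobs [simp]: "finite (two_jobs S B)"
  by (simp add: two_jobs_def)

text \<open>Choose \<open>B\<close> of least size. For nonempty \<open>X\<close>, the smaller set
  \<open>B - X\<close> is empty or not overcrowded, so the jobs inside it number at most its
  capacity. The other jobs inside \<open>B\<close> touch \<open>X\<close> and, as \<open>B\<close>
  is overcrowded, number at least the capacity of \<open>X\<close>.\<close>

lemma overcrowded_assignment:
  assumes "overcrowded S B0"
  shows "\<exists>B T. B \<subseteq> machines S \<and> B \<noteq> {} \<and>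
    (\<forall>i\<in>B. T i \<subseteq> two_jobs S B \<and> card (T i) = cap S i \<and> (\<forall>j\<in>T i. i \<in> req S j)) \<and>
    (\<forall>i\<in>B. \<forall>k\<in>B. i \<noteq> k \<longrightarrow> T i \<inter> T k = {})"
proof -
  obtain B where B: "overcrowded S B" and min: "\<And>X. overcrowded S X \<Longrightarrow> card B \<le> card X"
    using assms by (metis ex_has_least_nat)
  have sub: "B \<subseteq> machines S" "B \<noteq> {}" and fin: "finite B"
    using B by (auto simp: overcrowded_def intro: finite_subset[OF _ finite_machines])
  have fin_req: "finite (req S j)" if "j \<in> two_jobs S B" for j
    using that fin by (auto simp: two_jobs_def intro: finite_subset)
  have hall: "sum (cap S) X \<le> card {j \<in> two_jobs S B. req S j \<inter> X \<noteq> {}}" if X: "X \<subseteq> B" for X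
  proof (cases "X = {}")
    case False
    let ?Y = "B - X"
    have "sum (cap S) ?Y \<ge> card (two_jobs S ?Y)"
    proof (rule ccontr)
      assume less: "\<not> ?thesis"
      have "two_jobs S {} = {}" by (auto simp: two_jobs_def)
      with less have "?Y \<noteq> {}" by (metis card.empty sum.empty le_refl)
      with less have "overcrowded S ?Y" using sub by (auto simp: overcrowded_def)
      then have "card B \<le> card ?Y" by (rule min)
      moreover have "card ?Y < card B" using False X fin by (intro psubset_card_mono) auto
      ultimately show False by simp
    qed
    moreover have "sum (cap S) B = sum (cap S) X + sum (cap S) ?Y"
      using X fin by (metis add.commute sum.subset_diff)
    moreover have "card (two_jobs S B) = card {j \<in> two_jobs S B. req S j \<inter> X \<noteq> {}} + card (two_jobs S ?Y)"
    proof -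
      have "two_jobs S B = {j \<in> two_jobs S B. req S j \<inter> X \<noteq> {}} \<union> two_jobs S ?Y"
        by (auto simp: two_jobs_def)
      moreover have "{j \<in> two_jobs S B. req S j \<inter> X \<noteq> {}} \<inter> two_jobs S ?Y = {}"
        by (auto simp: two_jobs_def)
      ultimately show ?thesis
        by (metis (no_types, lifting) card_Un_disjoint finite_Un finite_two_jobs)
    qed
    ultimately show ?thesis using B by (simp add: overcrowded_def)
  qed simp
  obtain M where M: "\<And>j. j \<in> two_jobs S B \<Longrightarrow> M j \<subseteq> req S j \<and> card (M j) \<le> 1"
    and cM: "\<And>i. i \<in> B \<Longrightarrow> cap S i \<le> card {j \<in> two_jobs S B. i \<in> M j}"
    using hall_orientation[OF finite_two_jobs fin fin_req hall] by blast
  have "\<forall>i\<in>B. \<exists>T. T \<subseteq> {j \<in> two_jobs S B. i \<in> M j} \<and> card T = cap S i"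
    using cM by (meson obtain_subset_with_card_n)
  then obtain T where T: "\<And>i. i \<in> B \<Longrightarrow> T i \<subseteq> {j \<in> two_jobs S B. i \<in> M j} \<and> card (T i) = cap S i"
    by metis
  have "T i \<inter> T k = {}" if ik: "i \<in> B" "k \<in> B" "i \<noteq> k" for i k
  proof (rule ccontr)
    assume "T i \<inter> T k \<noteq> {}"
    then obtain j where j: "j \<in> two_jobs S B" "i \<in> M j" "k \<in> M j"
      using T[OF ik(1)] T[OF ik(2)] by blast
    have "finite (M j)" using M[OF j(1)] fin_req[OF j(1)] finite_subset by blast
    then show False using M[OF j(1)] j ik(3) by (metis One_nat_def card_le_Suc0_iff_eq)
  qed
  moreover have "T i \<subseteq> two_jobs S B \<and> card (T i) = cap S i \<and> (\<forall>j\<in>T i. i \<in> req S j)" if "i \<in> B" for i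
    using T[OF that] M by blast
  ultimately show ?thesis using sub by (intro exI[of _ B] exI[of _ T]) simp
qed

section \<open>States and their successors\<close>

lemma remaining_machine:
  assumes "well_formed S" "is_state S s" "j \<in> jobs S" "i \<in> remaining s j"
  shows "i \<in> machines S"
proof -
  have "remaining s j \<subseteq> req S j" using assms(2,3) unfolding is_state_def by blast
  moreover have "req S j \<subseteq> machines S" using assms(1,3) unfolding well_formed_def by blast
  ultimately show ?thesis using assms(4) by blast
qed

lemma successor_is_state:
  assumes "well_formed S" "is_state S s" "successor S s t"
  shows "is_state S t"
  using assms(3)
proof cases
  case (to_machine j i)
  have i: "i \<in> machines S"
    using remaining_machine[OF assms(1,2)] to_machine(2,3) by blast
  have "load S t k \<le> cap S k" if k: "k \<in> machines S" for k
  proof (cases "k = i")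
    case True
    have "{l \<in> jobs S. location t l = k} \<subseteq> insert j {l \<in> jobs S. location s l = k}"
      using to_machine True by auto
    then have "card {l \<in> jobs S. location t l = k} \<le> card (insert j {l \<in> jobs S. location s l = k})"
      by (intro card_mono) auto
    also have "\<dots> \<le> Suc (load S s k)" by (simp add: load_def card_insert_if)
    finally have "load S t k \<le> Suc (load S s k)" by (simp add: load_def)
    then show ?thesis using to_machine True by simp
  next
    case False
    then have "{l \<in> jobs S. location t l = k} \<subseteq> {l \<in> jobs S. location s l = k}"
      using to_machine by auto
    then have "load S t k \<le> load S s k" unfolding load_def by (intro card_mono) auto
    then show ?thesis using assms(2) k by (auto simp: is_state_def)
  qed
  then show ?thesis
    using assms(2) i to_machine by (auto simp: is_state_def machines_def)
next
  case (to_exit j)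
  have "load S t k \<le> cap S k" if k: "k \<in> machines S" for k
  proof -
    have "{l \<in> jobs S. location t l = k} \<subseteq> {l \<in> jobs S. location s l = k}"
      using to_exit k by (auto simp: machines_def)
    then have "load S t k \<le> load S s k" unfolding load_def by (intro card_mono) auto
    then show ?thesis using assms(2) k by (auto simp: is_state_def)
  qed
  then show ?thesis
    using assms(2) to_exit by (auto simp: is_state_def)
qed

lemma initial_is_state: "well_formed S \<Longrightarrow> is_state S (initial_state S)"
  by (fastforce simp: is_state_def initial_state_def well_formed_def load_def machines_def)

lemma reachable_is_state:
  assumes "well_formed S" "(successor S)\<^sup>*\<^sup>* s t" "is_state S s"
  shows "is_state S t"
  using assms(2,3) by induction (auto intro: successor_is_state[OF assms(1)])

text \<open>The predicate \<open>is_state\<close> allows a job to sit on a machine outside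
  \<open>req S j\<close>. On runs from the initial state this cannot happen, and the counting of
  jobs in a deadlock depends on it.\<close>

lemma reachable_location:
  assumes "(successor S)\<^sup>*\<^sup>* (initial_state S) s" "well_formed S" "j \<in> jobs S" "location s j \<in> machines S"
  shows "location s j \<in> req S j"
proof -
  have "is_state S s \<and> (\<forall>j\<in>jobs S. location s j \<in> machines S \<longrightarrow> location s j \<in> req S j)"
    using assms(1)
  proof induction
    case base
    then show ?case
      using initial_is_state[OF assms(2)] by (simp add: initial_state_def machines_def)
  next
    case (step t u)
    have "is_state S u" using successor_is_state[OF assms(2)] step by blast
    moreover have "\<forall>j\<in>jobs S. location u j \<in> machines S \<longrightarrow> location u j \<in> req S j"
      using step.hyps(2) step.IH by cases (auto simp: is_state_def machines_def)
    ultimately show ?case by simp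
  qed
  then show ?thesis using assms(3,4) by blast
qed

text \<open>Let \<open>B\<close> consist of the full machines. Whatever a job waits for is full, and
  some job waits, so \<open>B\<close> is nonempty. A job on a machine of \<open>B\<close> cannot
  exit, so it still needs another machine, again in \<open>B\<close>; having at most two machines,
  it is an edge inside \<open>B\<close>.\<close>

lemma deadlock_imp_overcrowded:
  assumes wf: "well_formed S" and two: "\<And>j. j \<in> jobs S \<Longrightarrow> card (req S j) \<le> 2"
    and reach: "(successor S)\<^sup>*\<^sup>* (initial_state S) s" and dead: "deadlock S s"
  shows "\<exists>B. overcrowded S B"
proof -
  let ?B = "{i \<in> machines S. cap S i \<le> load S s i}"
  have st: "is_state S s" and stuck: "\<And>t. \<not> successor S s t" and nf: "\<not> is_final S s"
    using dead by (auto simp: deadlock_def)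
  have full: "i \<in> ?B" if "j \<in> jobs S" "i \<in> remaining s j" for i j
  proof -
    have "i \<in> machines S" using remaining_machine[OF wf st that] .
    moreover have "cap S i \<le> load S s i"
      using successor.to_machine[OF that] stuck by (meson not_le)
    ultimately show ?thesis by simp
  qed
  have rem: "remaining s j \<noteq> {}" if "j \<in> jobs S" "location s j \<noteq> nmach S + 1" for j
    using successor.to_exit[OF that(1) _ that(2)] stuck by blast
  have "?B \<noteq> {}"
  proof -
    obtain j where j: "j \<in> jobs S" "\<not> (location s j = nmach S + 1 \<and> remaining s j = {})"
      using nf by (auto simp: is_final_def)
    then have "remaining s j \<noteq> {}" using rem by blast
    then show ?thesis using full[OF j(1)] by blast
  qed
  moreover have "sum (cap S) ?B \<le> card (two_jobs S ?B)"
  proof -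
    have "sum (cap S) ?B \<le> sum (load S s) ?B" by (intro sum_mono) auto
    also have "\<dots> = card (\<Union>i\<in>?B. {j \<in> jobs S. location s j = i})"
      unfolding load_def by (subst card_UN_disjoint) auto
    also have "\<dots> \<le> card (two_jobs S ?B)"
    proof (intro card_mono finite_two_jobs subsetI)
      fix j assume "j \<in> (\<Union>i\<in>?B. {j \<in> jobs S. location s j = i})"
      then have j: "j \<in> jobs S" "location s j \<in> ?B" by auto
      then have loc: "location s j \<in> req S j" using reachable_location[OF reach wf] by auto
      have "remaining s j \<noteq> {}" using rem[OF j(1)] j(2) by (auto simp: machines_def)
      then obtain b where b: "b \<in> remaining s j" by blast
      then have b': "b \<in> req S j" "b \<noteq> location s j" "b \<in> ?B"
        using st j(1) full[OF j(1) b] by (auto simp: is_state_def)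
      have fin: "finite (req S j)"
        using wf j(1) finite_subset[OF _ finite_machines] unfolding well_formed_def by blast
      have sub: "{location s j, b} \<subseteq> req S j" using loc b' by auto
      have "card {location s j, b} = 2" using b' by auto
      then have "req S j = {location s j, b}"
        using sub two[OF j(1)] fin by (metis card_seteq)
      then show "j \<in> two_jobs S ?B" using j b' by (auto simp: two_jobs_def)
    qed
    finally show ?thesis .
  qed
  ultimately have "overcrowded S ?B" by (simp add: overcrowded_def)
  then show ?thesis ..
qed

text \<open>
  The weight 2 is needed because \<open>is_state\<close> does not exclude jobs on the exit machine that still
  have remaining machines.
\<close>

definition moves_left :: "open_shop \<Rightarrow> state \<Rightarrow> nat" where
  "moves_left S s =
     (\<Sum>j\<in>jobs S. 2 * card (remaining s j) + (if location s j = nmach S + 1 then 0 else 1))"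

lemma successor_moves_left:
  assumes wf: "well_formed S" and st: "is_state S s" and suc: "successor S s t"
  shows "moves_left S t < moves_left S s"
proof -
  let ?w = "\<lambda>s j. 2 * card (remaining s j) + (if location s j = nmach S + 1 then 0 else 1)"
  have fin: "finite (remaining s j)" if "j \<in> jobs S" for j
    using that st wf by (meson Diff_subset finite_machines finite_subset is_state_def well_formed_def)
  have "\<exists>j\<in>jobs S. ?w t j < ?w s j \<and> (\<forall>k. k \<noteq> j \<longrightarrow> ?w t k = ?w s k)"
    using suc
  proof cases
    case (to_machine j i)
    then have "0 < card (remaining s j)" using fin by (auto simp: card_gt_0_iff)
    then have "?w t j < ?w s j" using to_machine fin by (auto simp: card_Diff_singleton)
    then show ?thesis using to_machine by (intro bexI[of _ j]) auto
  next
    case (to_exit j)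
    then show ?thesis by (intro bexI[of _ j]) auto
  qed
  then show ?thesis
    unfolding moves_left_def by (intro sum_strict_mono_ex1) (simp, metis le_less, blast)
qed

section \<open>Filling a set of machines for good\<close>

definition parked :: "open_shop \<Rightarrow> (nat \<Rightarrow> nat set) \<Rightarrow> nat set \<Rightarrow> state \<Rightarrow> bool" where
  "parked S T B s \<longleftrightarrow> (\<forall>i\<in>B. \<forall>j\<in>T i. location s j = i \<and> remaining s j = req S j - {i})"

text \<open>The jobs in \<open>T i\<close> fill \<open>i\<close>, and each of them waits only for
  its other machine, which lies in \<open>B\<close> and is full as well. So it can neither move nor
  exit.\<close>

lemma parked_successor:
  assumes T: "\<And>i. i \<in> B \<Longrightarrow> T i \<subseteq> two_jobs S B \<and> card (T i) = cap S i \<and> (\<forall>j\<in>T i. i \<in> req S j)"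
    and park: "parked S T B s" and suc: "successor S s t"
  shows "parked S T B t"
proof -
  have full: "cap S b \<le> load S s b" if "b \<in> B" for b
  proof -
    have "T b \<subseteq> {j \<in> jobs S. location s j = b}"
      using T[OF that] park that by (auto simp: parked_def two_jobs_def)
    then show ?thesis 
      unfolding load_def using T[OF that] card_mono[of "{j \<in> jobs S. location s j = b}" "T b"] by simp
  qed
  have rem: "remaining s j \<noteq> {} \<and> remaining s j \<subseteq> B" if "i \<in> B" "j \<in> T i" for i j
  proof -
    have "card (req S j) = 2" "req S j \<subseteq> B" "i \<in> req S j"
      using T[OF that(1)] that(2) by (auto simp: two_jobs_def)
    moreover from this have "req S j \<noteq> {i}" by auto
    ultimately show ?thesis using park that by (auto simp: parked_def)
  qed
  have stay: "j \<notin> T i" if "i \<in> B" "location t j \<noteq> location s j \<or> remaining t j \<noteq> remaining s j" for i j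
    using suc
  proof cases
    case (to_machine j' b)
    show ?thesis
    proof
      assume "j \<in> T i"
      then have "b \<in> B" using rem[OF that(1)] that(2) to_machine by (auto split: if_splits)
      then show False using full to_machine by (meson not_le)
    qed
  next
    case (to_exit j')
    then show ?thesis using rem[OF that(1)] that(2) by (auto split: if_splits)
  qed
  show ?thesis
    using park stay unfolding parked_def by metis
qed

text \<open>The jobs come straight from the entry machine, one at a time; \<open>A\<close> is the
  set of those already moved. All others are still at the entry, so \<open>i\<close> holds only jobs
  of \<open>T i\<close> and has room until all \<open>cap S i\<close> of them have arrived.\<close>

lemma reach_parked:
  assumes sub: "B \<subseteq> machines S"
    and T: "\<And>i. i \<in> B \<Longrightarrow> T i \<subseteq> two_jobs S B \<and> card (T i) = cap S i \<and> (\<forall>j\<in>T i. i \<in> req S j)"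
    and disj: "\<And>i k. i \<in> B \<Longrightarrow> k \<in> B \<Longrightarrow> i \<noteq> k \<Longrightarrow> T i \<inter> T k = {}"
  shows "\<exists>s. (successor S)\<^sup>*\<^sup>* (initial_state S) s \<and> parked S T B s"
proof -
  have U: "(\<Union>i\<in>B. T i) \<subseteq> jobs S" using T by (auto simp: two_jobs_def)
  have "\<exists>s. (successor S)\<^sup>*\<^sup>* (initial_state S) s \<and>
      (\<forall>i\<in>B. \<forall>j\<in>T i \<inter> A. location s j = i \<and> remaining s j = req S j - {i}) \<and>
      (\<forall>j. j \<notin> A \<longrightarrow> location s j = 0 \<and> remaining s j = req S j)"
    if "finite A" "A \<subseteq> (\<Union>i\<in>B. T i)" for A
    using that
  proof induction
    case empty
    show ?case by (rule exI[of _ "initial_state S"]) (simp add: initial_state_def)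
  next
    case (insert j A)
    then obtain s where s: "(successor S)\<^sup>*\<^sup>* (initial_state S) s"
      "\<And>i j. i \<in> B \<Longrightarrow> j \<in> T i \<Longrightarrow> j \<in> A \<Longrightarrow> location s j = i \<and> remaining s j = req S j - {i}"
      "\<And>j. j \<notin> A \<Longrightarrow> location s j = 0 \<and> remaining s j = req S j" by auto
    obtain i where i: "i \<in> B" "j \<in> T i" using insert by auto
    have fT: "finite (T i)" using T[OF i(1)] finite_subset finite_two_jobs by blast
    have "{l \<in> jobs S. location s l = i} \<subseteq> T i - {j}"
    proof
      fix l assume "l \<in> {l \<in> jobs S. location s l = i}"
      then have l: "location s l = i" by simp
      \<comment> \<open>Machines of \<open>B\<close> differ from the entry machine 0, so a job found
        on \<open>i\<close> has already been moved.\<close>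
      have "i \<noteq> 0" using i sub by (auto simp: machines_def)
      then have lA: "l \<in> A" using s(3)[of l] l by auto
      then obtain k where "k \<in> B" "l \<in> T k" using insert by auto
      then have "l \<in> T i" using s(2)[of k l] lA l by auto
      then show "l \<in> T i - {j}" using lA insert by auto
    qed
    then have "load S s i \<le> card (T i - {j})" unfolding load_def using fT by (intro card_mono) auto
    also have "\<dots> < cap S i" using T[OF i(1)] i(2) fT by (metis card_Diff1_less)
    finally have room: "load S s i < cap S i" .
    have j: "j \<in> jobs S" "i \<in> remaining s j"
      using U i T[OF i(1)] s(3)[of j] insert by auto
    let ?t = "\<lparr>location = (location s)(j := i), remaining = (remaining s)(j := remaining s j - {i})\<rparr>"
    have "(successor S)\<^sup>*\<^sup>* (initial_state S) ?t"
      using s(1) successor.to_machine[OF j room] by (rule rtranclp.rtrancl_into_rtrancl)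
    moreover have "location ?t l = k \<and> remaining ?t l = req S l - {k}"
      if "k \<in> B" "l \<in> T k" "l \<in> insert j A" for k l
    proof (cases "l = j")
      case True
      then have "k = i" using disj[OF i(1) that(1)] i(2) that(2) by blast
      then show ?thesis using True s(3)[of j] insert by simp
    next
      case False
      then show ?thesis using s(2)[OF that(1,2)] that(3) by simp
    qed
    moreover have "location ?t l = 0 \<and> remaining ?t l = req S l" if "l \<notin> insert j A" for l
      using that s(3)[of l] by auto
    ultimately show ?case by (intro exI[of _ ?t]) blast
  qed
  from this[OF finite_subset[OF U finite_jobs] subset_refl] show ?thesis
    unfolding parked_def by (metis (no_types, lifting) Int_iff UN_I)
qed

text \<open>Every run is finite because \<open>moves_left\<close> decreases, and its last state is
  not final: capacities are positive, so some parked job is still on a machine of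
  \<open>B\<close>.\<close>

lemma parked_reaches_deadlock:
  assumes wf: "well_formed S" and sub: "B \<subseteq> machines S" "B \<noteq> {}"
    and T: "\<And>i. i \<in> B \<Longrightarrow> T i \<subseteq> two_jobs S B \<and> card (T i) = cap S i \<and> (\<forall>j\<in>T i. i \<in> req S j)"
    and st: "is_state S s" and park: "parked S T B s"
  shows "\<exists>t. (successor S)\<^sup>*\<^sup>* s t \<and> deadlock S t"
  using st park
proof (induction "moves_left S s" arbitrary: s rule: less_induct)
  case less
  show ?case
  proof (cases "\<exists>t. successor S s t")
    case True
    then obtain t where t: "successor S s t" by blast
    obtain u where "(successor S)\<^sup>*\<^sup>* t u" "deadlock S u"
      using less.hyps[OF successor_moves_left[OF wf less.prems(1) t]
          successor_is_state[OF wf less.prems(1) t] parked_successor[OF T less.prems(2) t]] by blast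
    then show ?thesis using converse_rtranclp_into_rtranclp[of "successor S", OF t] by blast
  next
    case False
    obtain i where i: "i \<in> B" using sub by blast
    then have "0 < cap S i" using wf sub unfolding well_formed_def by blast
    then obtain j where j: "j \<in> T i" using T[OF i] by (metis card_gt_0_iff ex_in_conv)
    then have "j \<in> jobs S" "location s j = i" "i \<in> machines S"
      using T[OF i] less.prems(2) i sub by (auto simp: two_jobs_def parked_def)
    then have "\<not> is_final S s" by (force simp: is_final_def machines_def)
    then show ?thesis using False less.prems by (auto simp: deadlock_def)
  qed
qed

text \<open>This eliminates states from the question; what remains is a density condition on a
  multigraph.\<close>

theorem reachable_deadlock_iff_overcrowded:
  assumes wf: "well_formed S" and two: "\<And>j. j \<in> jobs S \<Longrightarrow> card (req S j) \<le> 2"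
  shows "reachable_deadlock S \<longleftrightarrow> (\<exists>B. overcrowded S B)"
proof
  assume "reachable_deadlock S"
  then show "\<exists>B. overcrowded S B"
    using deadlock_imp_overcrowded[OF wf two] by (auto simp: reachable_deadlock_def)
next
  assume "\<exists>B. overcrowded S B"
  then obtain B0 where "overcrowded S B0" by blast
  from overcrowded_assignment[OF this] obtain B T where B: "B \<subseteq> machines S" "B \<noteq> {}"
    and T': "\<forall>i\<in>B. T i \<subseteq> two_jobs S B \<and> card (T i) = cap S i \<and> (\<forall>j\<in>T i. i \<in> req S j)"
    and disj: "\<forall>i\<in>B. \<forall>k\<in>B. i \<noteq> k \<longrightarrow> T i \<inter> T k = {}"
    by (elim exE conjE)
  note T = bspec[OF T']
  obtain s where s: "(successor S)\<^sup>*\<^sup>* (initial_state S) s" "parked S T B s"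
    using reach_parked[OF B(1) T] disj by blast
  have "is_state S s" using reachable_is_state[OF wf s(1)] initial_is_state[OF wf] by blast
  then obtain t where "(successor S)\<^sup>*\<^sup>* s t" "deadlock S t"
    using parked_reaches_deadlock[OF wf B T _ s(2)] by blast
  then show "reachable_deadlock S"
    using s(1) unfolding reachable_deadlock_def by (meson rtranclp_trans)
qed

section \<open>Balanced distributions of units\<close>

text \<open>
  Every edge \<open>(a, b)\<close> carries \<open>K\<close> units, \<open>x e\<close> of them at \<open>a\<close> and the others at \<open>b\<close>.
\<close>

definition units_at :: "nat \<Rightarrow> (nat \<times> nat) list \<Rightarrow> (nat \<Rightarrow> int) \<Rightarrow> nat \<Rightarrow> nat \<Rightarrow> int" where
  "units_at K es x i e =
     (if fst (es ! e) = i then x e else 0) + (if snd (es ! e) = i then int K - x e else 0)"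

definition slack :: "nat \<Rightarrow> (nat \<times> nat) list \<Rightarrow> (nat \<Rightarrow> nat) \<Rightarrow> (nat \<Rightarrow> int) \<Rightarrow> nat \<Rightarrow> int" where
  "slack K es c x i = int K * int (c i) - (\<Sum>e<length es. units_at K es x i e)"

text \<open>Local optimality for the sum of squared slacks: shifting a unit raises the slack where
  it leaves and lowers it where it arrives, which pays off exactly if the slack at the target is
  larger by at least 2.\<close>

definition balanced_at :: "nat \<Rightarrow> (nat \<times> nat) list \<Rightarrow> (nat \<Rightarrow> int) \<Rightarrow> (nat \<Rightarrow> int) \<Rightarrow> nat \<Rightarrow> bool" where
  "balanced_at K es x d e \<longleftrightarrow>
     (0 < x e \<longrightarrow> d (snd (es ! e)) \<le> d (fst (es ! e)) + 1) \<and>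
     (x e < int K \<longrightarrow> d (fst (es ! e)) \<le> d (snd (es ! e)) + 1)"

definition inner_edges :: "(nat \<times> nat) list \<Rightarrow> nat set \<Rightarrow> nat set" where
  "inner_edges es B = {e. e < length es \<and> fst (es ! e) \<in> B \<and> snd (es ! e) \<in> B}"

lemma sum_slack:
  assumes "finite B"
  shows "(\<Sum>i\<in>B. slack K es c x i) = int K * int (sum c B) -
    (\<Sum>e<length es. (if fst (es ! e) \<in> B then x e else 0) +
                     (if snd (es ! e) \<in> B then int K - x e else 0))"
proof -
  have "(\<Sum>i\<in>B. \<Sum>e<length es. units_at K es x i e) = (\<Sum>e<length es. \<Sum>i\<in>B. units_at K es x i e)"
    by (rule sum.swap)
  also have "\<dots> = (\<Sum>e<length es. (if fst (es ! e) \<in> B then x e else 0) +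
                     (if snd (es ! e) \<in> B then int K - x e else 0))"
    using assms by (simp add: units_at_def sum.distrib)
  finally show ?thesis
    by (simp add: slack_def sum_subtractf sum_distrib_left)
qed

lemma sum_inner_edges:
  "(\<Sum>e<length es. if fst (es ! e) \<in> B \<and> snd (es ! e) \<in> B then int K else 0) =
     int K * int (card (inner_edges es B))"
proof -
  have "{e \<in> {..<length es}. fst (es ! e) \<in> B \<and> snd (es ! e) \<in> B} = inner_edges es B"
    by (auto simp: inner_edges_def)
  then show ?thesis by (simp add: sum.If_cases Collect_conj_eq[symmetric] Int_def)
qed

text \<open>All \<open>K\<close> units of an edge inside \<open>B\<close> lie in \<open>B\<close>,
  and other edges can only add units. So the total slack, which is positive, is at most
  \<open>K\<close> times the excess of the capacity over the number of inner edges.\<close>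

lemma positive_slack_sparse:
  assumes "finite B" "B \<noteq> {}" and x: "\<And>e. e < length es \<Longrightarrow> 0 \<le> x e \<and> x e \<le> int K"
    and pos: "\<And>i. i \<in> B \<Longrightarrow> 0 < slack K es c x i"
  shows "card (inner_edges es B) < sum c B"
proof -
  have "0 < (\<Sum>i\<in>B. slack K es c x i)" using assms(1,2) pos by (intro sum_pos) auto
  moreover have "int K * int (card (inner_edges es B)) \<le> (\<Sum>e<length es. (if fst (es ! e) \<in> B then x e else 0) +
                     (if snd (es ! e) \<in> B then int K - x e else 0))"
    unfolding sum_inner_edges[symmetric] using x by (intro sum_mono) (auto)
  ultimately have "int K * int (card (inner_edges es B)) < int K * int (sum c B)"
    using sum_slack[OF assms(1), of K es c x] by linarith
  then have "int (card (inner_edges es B)) < int (sum c B)"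
    by (rule mult_left_less_imp_less) simp
  then show ?thesis by (simp only: of_nat_less_iff)
qed

text \<open>Pigeonhole: \<open>v\<close> takes none of the values from 1 to \<open>n\<close>, and
  the other \<open>n - 1\<close> indices cannot take them all. The value not taken is called
  \<open>k + 1\<close>, so that the slacks below it are those up to \<open>k\<close>.\<close>

lemma empty_level:
  fixes d :: "nat \<Rightarrow> int"
  assumes "v \<in> {1..n}" "d v \<le> 0"
  shows "\<exists>k. 0 \<le> k \<and> k < int n \<and> (\<forall>i\<in>{1..n}. d i \<noteq> k + 1)"
proof (rule ccontr)
  assume no: "\<not> ?thesis"
  have "{1..int n} \<subseteq> d ` ({1..n} - {v})"
  proof
    fix k assume "k \<in> {1..int n}"
    then obtain i where "i \<in> {1..n}" "d i = k" using no[simplified, rule_format, of "k - 1"] by auto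
    then show "k \<in> d ` ({1..n} - {v})" using assms \<open>k \<in> {1..int n}\<close> by (intro image_eqI[of _ _ i]) auto
  qed
  then have "card {1..int n} \<le> card (d ` ({1..n} - {v}))" by (intro card_mono) auto
  also have "\<dots> \<le> card ({1..n} - {v})" by (intro card_image_le) auto
  finally have "n \<le> n - 1" using assms(1) by (simp del: atLeastAtMost_iff)
  moreover have "0 < n" using assms(1) by simp
  ultimately show False by linarith
qed

text \<open>
  In a balanced distribution the slack increases by at most one from a machine holding a unit of an
  edge to the other end of that edge. So no unit on a machine below an empty level belongs to an
  edge that leaves the set of these machines.
\<close>

lemma nonpositive_slack_dense:
  assumes es: "\<And>e. e < length es \<Longrightarrow> fst (es ! e) \<in> {1..n} \<and> snd (es ! e) \<in> {1..n}"
    and x: "\<And>e. e < length es \<Longrightarrow> 0 \<le> x e \<and> x e \<le> int (n * n)"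
    and bal: "\<And>e. e < length es \<Longrightarrow> balanced_at (n * n) es x (slack (n * n) es c x) e"
    and v: "v \<in> {1..n}" "slack (n * n) es c x v \<le> 0"
  shows "\<exists>B\<subseteq>{1..n}. B \<noteq> {} \<and> sum c B \<le> card (inner_edges es B)"
proof -
  let ?K = "n * n" let ?d = "slack ?K es c x"
  obtain k where k: "0 \<le> k" "k < int n" "\<And>i. i \<in> {1..n} \<Longrightarrow> ?d i \<noteq> k + 1"
    using empty_level[of v n ?d] v by blast
  define B where "B = {i \<in> {1..n}. ?d i \<le> k}"
  have up: "w \<in> B" if "u \<in> B" "w \<in> {1..n}" "?d w \<le> ?d u + 1" for u w
  proof -
    have "?d w \<le> k + 1" "?d w \<noteq> k + 1" using that k(3)[of w] by (simp_all add: B_def)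
    then show ?thesis using that(2) by (simp add: B_def)
  qed
  \<comment> \<open>Each edge puts either all of its units into \<open>B\<close> or none: a unit in
    \<open>B\<close> on an edge leaving \<open>B\<close> would bridge the empty level.\<close>
  have "(\<Sum>e<length es. (if fst (es ! e) \<in> B then x e else 0) + (if snd (es ! e) \<in> B then int ?K - x e else 0))
    = (\<Sum>e<length es. if fst (es ! e) \<in> B \<and> snd (es ! e) \<in> B then int ?K else 0)"
  proof (rule sum.cong[OF refl])
    fix e assume "e \<in> {..<length es}"
    then have e: "e < length es" by simp
    have 1: "snd (es ! e) \<in> B" if "fst (es ! e) \<in> B" "x e \<noteq> 0"
      using es[OF e] bal[OF e] x[OF e] that(2)
      by (intro up[OF that(1)]) (simp_all add: balanced_at_def)
    have 2: "fst (es ! e) \<in> B" if "snd (es ! e) \<in> B" "x e \<noteq> int ?K"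
      using es[OF e] bal[OF e] x[OF e] that(2)
      by (intro up[OF that(1)]) (simp_all add: balanced_at_def)
    show "(if fst (es ! e) \<in> B then x e else 0) + (if snd (es ! e) \<in> B then int ?K - x e else 0) =
          (if fst (es ! e) \<in> B \<and> snd (es ! e) \<in> B then int ?K else 0)"
    proof (cases "fst (es ! e) \<in> B")
      case True
      then show ?thesis using 1 by (cases "snd (es ! e) \<in> B") auto
    next
      case False
      then show ?thesis using 2 by (cases "snd (es ! e) \<in> B"; cases "x e = int ?K") auto
    qed
  qed
  moreover have fin: "finite B" by (simp add: B_def)
  ultimately have "(\<Sum>i\<in>B. ?d i) = int ?K * int (sum c B) - int ?K * int (card (inner_edges es B))"
    by (simp only: sum_slack sum_inner_edges)
  \<comment> \<open>The reason for \<open>K = n * n\<close>: at most \<open>n\<close> slacks, each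
    at most \<open>k < n\<close>, add up to less than the units of a single edge.\<close>
  moreover have "(\<Sum>i\<in>B. ?d i) < int ?K"
  proof -
    have "(\<Sum>i\<in>B. ?d i) \<le> of_nat (card B) * k" by (rule sum_bounded_above) (simp add: B_def)
    also have "\<dots> \<le> int n * k"
      using card_mono[of "{1..n}" B] k(1) by (intro mult_right_mono) (simp_all add: B_def subset_iff)
    also have "\<dots> < int n * int n" using k v(1) by (intro mult_strict_left_mono) auto
    finally show ?thesis by simp
  qed
  ultimately have "int ?K * (int (sum c B) - int (card (inner_edges es B))) < int ?K * 1"
    by (simp add: algebra_simps)
  then have "int (sum c B) - int (card (inner_edges es B)) < 1"
    by (rule mult_left_less_imp_less) simp
  then have "sum c B \<le> card (inner_edges es B)" by linarith
  moreover have "v \<in> B" "B \<subseteq> {1..n}" using v k(1) by (auto simp: B_def)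
  ultimately show ?thesis by blast
qed

text \<open>Whichever balanced distribution is reached, the signs of its slacks give the
  answer.\<close>

theorem balanced_decides_density:
  assumes es: "\<And>e. e < length es \<Longrightarrow> fst (es ! e) \<in> {1..n} \<and> snd (es ! e) \<in> {1..n}"
    and x: "\<And>e. e < length es \<Longrightarrow> 0 \<le> x e \<and> x e \<le> int (n * n)"
    and bal: "\<And>e. e < length es \<Longrightarrow> balanced_at (n * n) es x (slack (n * n) es c x) e"
  shows "(\<exists>i\<in>{1..n}. slack (n * n) es c x i \<le> 0) \<longleftrightarrow>
    (\<exists>B\<subseteq>{1..n}. B \<noteq> {} \<and> sum c B \<le> card (inner_edges es B))"
proof
  assume "\<exists>B\<subseteq>{1..n}. B \<noteq> {} \<and> sum c B \<le> card (inner_edges es B)"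
  then obtain B where B: "B \<subseteq> {1..n}" "B \<noteq> {}" "sum c B \<le> card (inner_edges es B)" by blast
  show "\<exists>i\<in>{1..n}. slack (n * n) es c x i \<le> 0"
  proof (rule ccontr)
    assume "\<not> ?thesis"
    then have "card (inner_edges es B) < sum c B"
      using B x finite_subset[OF B(1)] by (intro positive_slack_sparse[where x = x and K = "n * n"]) (auto simp: not_le)
    with B(3) show False by simp
  qed
qed (use nonpositive_slack_dense[OF es x bal] in blast)

section \<open>Moving single units, with the energy as termination measure\<close>

text \<open>With \<open>\<delta> = 1\<close> a unit goes from the first end to the second, with
  \<open>\<delta> = - 1\<close> it goes back; the slack grows where the unit leaves.\<close>

lemma slack_move:
  assumes "e < length es" "fst (es ! e) \<noteq> snd (es ! e)"
  shows "slack K es c (x(e := x e - \<delta>)) =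
    (slack K es c x)(fst (es ! e) := slack K es c x (fst (es ! e)) + \<delta>,
                     snd (es ! e) := slack K es c x (snd (es ! e)) - \<delta>)"
proof
  fix i
  have "(\<Sum>f<length es. units_at K es (x(e := x e - \<delta>)) i f) =
      (\<Sum>f<length es. units_at K es x i f + (if f = e then (if snd (es ! e) = i then \<delta> else 0) - (if fst (es ! e) = i then \<delta> else 0) else 0))"
    by (intro sum.cong) (auto simp: units_at_def)
  also have "\<dots> = (\<Sum>f<length es. units_at K es x i f) + ((if snd (es ! e) = i then \<delta> else 0) - (if fst (es ! e) = i then \<delta> else 0))"
    using assms(1) by (simp add: sum.distrib)
  finally show "slack K es c (x(e := x e - \<delta>)) i =
    ((slack K es c x)(fst (es ! e) := slack K es c x (fst (es ! e)) + \<delta>,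
                     snd (es ! e) := slack K es c x (snd (es ! e)) - \<delta>)) i"
    using assms(2) by (auto simp: slack_def)
qed

definition energy :: "nat \<Rightarrow> (nat \<Rightarrow> int) \<Rightarrow> nat" where
  "energy n d = nat (\<Sum>i=1..n. d i * d i)"

text \<open>The two squares together change by \<open>2 * (d a - d b) + 2\<close> for
  \<open>\<delta> = 1\<close> and by \<open>2 * (d b - d a) + 2\<close> for
  \<open>\<delta> = - 1\<close>; a gap of 2 makes this negative.\<close>

lemma energy_move:
  assumes "a \<in> {1..n}" "b \<in> {1..n}" "a \<noteq> b" "d a + 2 \<le> d b \<and> \<delta> = 1 \<or> d b + 2 \<le> d a \<and> \<delta> = - 1"
  shows "energy n (d(a := d a + \<delta>, b := d b - \<delta>)) < energy n d"
proof -
  let ?d = "d(a := d a + \<delta>, b := d b - \<delta>)"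
  have split: "(\<Sum>i=1..n. f i) = f a + f b + (\<Sum>i\<in>{1..n} - {a, b}. f i)" for f :: "nat \<Rightarrow> int"
  proof -
    have "(\<Sum>i=1..n. f i) = (\<Sum>i\<in>{a, b}. f i) + (\<Sum>i\<in>{1..n} - {a, b}. f i)"
      using assms by (metis (no_types, lifting) add.commute empty_subsetI finite_atLeastAtMost insert_subset sum.subset_diff)
    then show ?thesis using assms(3) by simp
  qed
  have "(\<Sum>i\<in>{1..n} - {a, b}. ?d i * ?d i) = (\<Sum>i\<in>{1..n} - {a, b}. d i * d i)"
    by (intro sum.cong) auto
  moreover have "(d a + \<delta>) * (d a + \<delta>) + (d b - \<delta>) * (d b - \<delta>) < d a * d a + d b * d b"
    using assms(4) by (auto simp: algebra_simps)
  ultimately have "(\<Sum>i=1..n. ?d i * ?d i) < (\<Sum>i=1..n. d i * d i)"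
    unfolding split using assms(3) by simp
  moreover have "0 \<le> (\<Sum>i=1..n. ?d i * ?d i)" by (intro sum_nonneg) auto
  ultimately show ?thesis unfolding energy_def by (simp only: nat_less_eq_zless)
qed

text \<open>Every slack is a difference of two numbers between 0 and \<open>K * N\<close>, since
  each of at most \<open>N\<close> edges puts at most \<open>K\<close> units on a machine.\<close>

lemma energy_bound:
  assumes x: "\<And>e. e < length es \<Longrightarrow> 0 \<le> x e \<and> x e \<le> int K"
    and simple: "\<And>e. e < length es \<Longrightarrow> fst (es ! e) \<noteq> snd (es ! e)"
    and c: "\<And>i. i \<in> {1..n} \<Longrightarrow> c i \<le> N" and len: "length es \<le> N"
  shows "energy n (slack K es c x) \<le> n * (K * N)\<^sup>2"
proof -
  have bound: "\<bar>slack K es c x i\<bar> \<le> int (K * N)" if i: "i \<in> {1..n}" for i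
  proof -
    have u: "0 \<le> units_at K es x i e \<and> units_at K es x i e \<le> int K" if "e < length es" for e
      using x[OF that] simple[OF that] by (auto simp: units_at_def)
    have "0 \<le> (\<Sum>e<length es. units_at K es x i e)" using u by (intro sum_nonneg) auto
    moreover have "(\<Sum>e<length es. units_at K es x i e) \<le> of_nat (card {..<length es}) * int K"
      using u by (intro sum_bounded_above) auto
    moreover have "int (length es) * int K \<le> int N * int K" using len by (intro mult_right_mono) auto
    moreover have "int K * int (c i) \<le> int K * int N" using c[OF i] by (intro mult_left_mono) auto
    moreover have "0 \<le> int K * int (c i)" by simp
    ultimately show ?thesis unfolding slack_def
      by (simp only: abs_le_iff card_lessThan of_nat_mult mult.commute[of _ "int K"]) linarith
  qed
  have "(\<Sum>i=1..n. slack K es c x i * slack K es c x i) \<le> of_nat (card {1..n}) * (int (K * N))\<^sup>2"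
  proof (rule sum_bounded_above)
    fix i assume "i \<in> {1..n}"
    then show "slack K es c x i * slack K es c x i \<le> (int (K * N))\<^sup>2"
      using bound abs_le_square_iff[of "slack K es c x i" "int (K * N)"] by (simp add: power2_eq_square)
  qed
  then show ?thesis unfolding energy_def by (simp add: nat_le_iff)
qed

section \<open>Counting steps instead of cost\<close>

text \<open>\<open>k\<close> is a budget of steps, including the halting instruction. Recursion on
  the budget lets a run be evaluated by rewriting, and logarithmic costs are postponed to a single
  general lemma.\<close>

primrec decides :: "program \<Rightarrow> nat \<Rightarrow> nat \<Rightarrow> (nat \<Rightarrow> int) \<Rightarrow> int list \<Rightarrow> bool \<Rightarrow> bool" where
  "decides P 0 l r xs b = False"
| "decides P (Suc k) l r xs b \<longleftrightarrow> l < length P \<and>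
     (case P ! l of
        Const i x \<Rightarrow> decides P k (Suc l) (r(i := x)) xs b
      | Add i j m \<Rightarrow> decides P k (Suc l) (r(i := r j + r m)) xs b
      | Sub i j m \<Rightarrow> decides P k (Suc l) (r(i := r j - r m)) xs b
      | Load i j \<Rightarrow> 0 \<le> r j \<and> decides P k (Suc l) (r(i := r (nat (r j)))) xs b
      | Store i j \<Rightarrow> 0 \<le> r i \<and> decides P k (Suc l) (r(nat (r i) := r j)) xs b
      | Jump_pos m j \<Rightarrow> if 0 < r j then decides P k m r xs b else decides P k (Suc l) r xs b
      | Read i \<Rightarrow> (case xs of [] \<Rightarrow> False | x # ys \<Rightarrow> decides P k (Suc l) (r(i := x)) ys b)
      | Accept \<Rightarrow> b
      | Reject \<Rightarrow> \<not> b)"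

lemma decides_mono: "decides P k l r xs b \<Longrightarrow> k \<le> k' \<Longrightarrow> decides P k' l r xs b"
proof (induction k arbitrary: k' l r xs)
  case (Suc k)
  then obtain m where m: "k' = Suc m" "k \<le> m" by (cases k') auto
  have IH: "decides P k l r xs b \<Longrightarrow> decides P m l r xs b" for l r xs
    using Suc.IH m(2) by blast
  from Suc.prems(1) show ?case unfolding m(1)
    by (auto split: instr.splits list.splits intro: IH)
qed simp

lemma int_size_mono: "\<bar>x\<bar> \<le> \<bar>y\<bar> \<Longrightarrow> int_size x \<le> int_size y"
  by (simp add: int_size_def floorlog_mono nat_mono)

lemma int_size_double: "int_size (2 * x) \<le> Suc (int_size x)"
proof (cases "x = 0")
  case False
  then have "nat \<bar>2 * x\<bar> = nat \<bar>x\<bar> * 2 ^ 1" by (simp add: abs_mult nat_mult_distrib)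
  then show ?thesis using False floorlog_power[where b = 2 and a = "nat \<bar>x\<bar>" and c = 1] by (simp add: int_size_def)
qed (simp add: int_size_def)

text \<open>In absolute value, \<open>z\<close> is at most twice the larger of the two numbers, and
  doubling adds at most one bit.\<close>

lemma int_size_arith:
  assumes "int_size x \<le> W" "int_size y \<le> W" "\<bar>z\<bar> \<le> \<bar>x\<bar> + \<bar>y\<bar>"
  shows "int_size z \<le> Suc W"
proof -
  define m where "m = max \<bar>x\<bar> \<bar>y\<bar>"
  have "int_size m \<le> W" using assms(1,2) by (auto simp: m_def max_def int_size_def)
  moreover have "int_size z \<le> int_size (2 * m)" using assms(3) by (intro int_size_mono) (auto simp: m_def)
  ultimately show ?thesis using int_size_double[of m] by linarith
qed

text \<open>
  Without multiplication, one step increases the maximal bit length by at most one. Hence a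
  polynomial bound on the number of steps suffices.
\<close>

lemma decides_halts:
  assumes "decides P k l r xs b" and "\<And>i. int_size (r i) \<le> W" and "\<And>x. x \<in> set xs \<Longrightarrow> int_size x \<le> W"
    and "\<And>i x. Const i x \<in> set P \<Longrightarrow> int_size x \<le> W"
  shows "\<exists>t \<le> 2 * k * (W + k). halts P \<lparr>pc = l, regs = r, input = xs\<rparr> t b"
  using assms
proof (induction k arbitrary: l r xs W)
  case (Suc k)
  let ?c = "\<lparr>pc = l, regs = r, input = xs\<rparr>"
  from Suc.prems(1) have l: "l < length P" by simp
  then have mem: "P ! l \<in> set P" by simp
  have W: "1 \<le> W" using Suc.prems(2)[of 0] by (simp add: int_size_def)
  have go: "\<exists>t \<le> 2 * Suc k * (W + Suc k). halts P ?c t b"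
    if ex: "exec (P ! l) ?c = Some (\<lparr>pc = l', regs = r', input = xs'\<rparr>, cost)" and cost: "cost \<le> 2 * W"
      and dec: "decides P k l' r' xs' b" and r': "\<And>i. int_size (r' i) \<le> Suc W" and xs': "set xs' \<subseteq> set xs"
    for l' r' xs' cost
  proof -
    obtain t where t: "t \<le> 2 * k * (Suc W + k)" "halts P \<lparr>pc = l', regs = r', input = xs'\<rparr> t b"
      using Suc.IH[OF dec r'] Suc.prems(3,4) xs' by (meson le_SucI subset_iff)
    have "halts P ?c (cost + t) b"
      using l ex t(2) by (intro halts.step) auto
    \<comment> \<open>The first instruction costs at most \<open>2 * W\<close>. For the other
      \<open>k\<close> steps the width bound is \<open>Suc W\<close>, and \<open>Suc W + k\<close>
      equals \<open>W + Suc k\<close>.\<close>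
    moreover have "cost + t \<le> 2 * Suc k * (W + Suc k)"
      using cost t(1) by (simp add: algebra_simps)
    ultimately show ?thesis by blast
  qed
  have upd: "int_size ((r(i := x)) m) \<le> Suc W" if "int_size x \<le> Suc W" for i x m
    using that Suc.prems(2)[of m] by auto
  have le: "int_size (r i) \<le> Suc W" for i using Suc.prems(2)[of i] by simp
  have one: "1 \<le> 2 * Suc k * (W + Suc k)" by simp
  show ?case
  proof (cases "P ! l")
    case (Const i x)
    show ?thesis
      by (rule go[of "Suc l" "r(i := x)" xs 1])
        (use Const Suc.prems(1) Suc.prems(4)[of i x] mem W in \<open>auto simp: assign_def le intro: le_SucI\<close>)
  next
    case (Add i j m)
    have "int_size (r j + r m) \<le> Suc W" using Suc.prems(2) by (intro int_size_arith[of "r j" _ "r m"]) auto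
    then show ?thesis
      by (intro go[of "Suc l" "r(i := r j + r m)" xs "int_size (r j) + int_size (r m)"])
        (use Add Suc.prems(1) Suc.prems(2)[of j] Suc.prems(2)[of m] in \<open>auto simp: assign_def le\<close>)
  next
    case (Sub i j m)
    have "int_size (r j - r m) \<le> Suc W" using Suc.prems(2) by (intro int_size_arith[of "r j" _ "r m"]) auto
    then show ?thesis
      by (intro go[of "Suc l" "r(i := r j - r m)" xs "int_size (r j) + int_size (r m)"])
        (use Sub Suc.prems(1) Suc.prems(2)[of j] Suc.prems(2)[of m] in \<open>auto simp: assign_def le\<close>)
  next
    case (Load i j)
    show ?thesis
      by (rule go[of "Suc l" "r(i := r (nat (r j)))" xs "int_size (r j) + int_size (r (nat (r j)))"])
        (use Load Suc.prems(1) Suc.prems(2)[of j] Suc.prems(2)[of "nat (r j)"] in \<open>auto simp: assign_def le\<close>)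
  next
    case (Store i j)
    show ?thesis
      by (rule go[of "Suc l" "r(nat (r i) := r j)" xs "int_size (r i) + int_size (r j)"])
        (use Store Suc.prems(1) Suc.prems(2)[of j] Suc.prems(2)[of i] in \<open>auto simp: assign_def le\<close>)
  next
    case (Jump_pos m j)
    show ?thesis
      by (rule go[of "if 0 < r j then m else Suc l" r xs "int_size (r j)"])
        (use Jump_pos Suc.prems(1) Suc.prems(2)[of j] in \<open>auto simp: le\<close>)
  next
    case (Read i)
    with Suc.prems(1) obtain x ys where xs: "xs = x # ys" by (auto split: list.splits)
    show ?thesis
      by (rule go[of "Suc l" "r(i := x)" ys "int_size x"])
        (use Read xs Suc.prems(1) Suc.prems(3)[of x] in \<open>auto simp: assign_def le intro: le_SucI\<close>)
  next
    case Accept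
    then show ?thesis using Suc.prems(1) l one halts.accept[of ?c P] by auto
  next
    case Reject
    then show ?thesis using Suc.prems(1) l one halts.reject[of ?c P] by auto
  qed
qed simp

section \<open>The program\<close>

text \<open>
  Register 0 stays 0, register 1 holds 1, register 2 the number \<open>n\<close> of machines, register 3 the
  number of jobs, and register 4 the number \<open>n * n\<close> of units per edge. The slack of machine \<open>i\<close> is
  kept in register \<open>20 + i\<close>; from register \<open>21 + n\<close> on, every edge occupies three registers: the
  addresses of the slacks of its two ends, and the number of its units at the first end.
  Register 5 points behind the last edge, register 6 to the first edge, and register 8 holds 20.
\<close>

definition prog :: program where
  "prog =
    [Const 1 1, Const 8 20, Read 2, Read 3,
     \<comment> \<open>4: multiplication \<open>n * n\<close>\<close>
     Add 9 2 0, Jump_pos 8 1,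
     Add 4 4 2, Sub 9 9 1, Jump_pos 6 9,
     \<comment> \<open>9: capacities; the inner loop truncates at the number of jobs plus 1 while it multiplies\<close>
     Add 5 8 1, Add 9 2 0, Jump_pos 25 1,
     Read 10, Add 11 3 1, Const 12 0, Jump_pos 19 1,
     Add 12 12 4, Sub 10 10 1, Sub 11 11 1,
     Jump_pos 21 10, Jump_pos 22 1, Jump_pos 16 11,
     Store 5 12, Add 5 5 1, Sub 9 9 1,
     Jump_pos 12 9,
     \<comment> \<open>26: jobs; those with fewer than two machines are skipped\<close>
     Add 6 5 0, Add 9 3 0, Jump_pos 50 1,
     Read 10, Sub 11 10 1, Jump_pos 36 11, Jump_pos 34 10, Jump_pos 49 1,
     Read 10, Jump_pos 49 1,
     Read 10, Add 10 10 8, Read 11, Add 11 11 8,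
     Store 5 10, Add 5 5 1, Store 5 11, Add 5 5 1, Store 5 4, Add 5 5 1,
     Load 12 10, Sub 12 12 4, Store 10 12,
     Sub 9 9 1,
     Jump_pos 29 9,
     \<comment> \<open>51: balancing; every move restarts the scan of the edges\<close>
     Add 7 6 0,
     Sub 9 5 7, Jump_pos 55 9, Jump_pos 86 1,
     Load 10 7, Add 13 7 1, Load 11 13, Add 13 13 1, Load 12 13, Load 14 10, Load 15 11,
     Sub 16 15 14, Sub 16 16 1, Jump_pos 74 16,
     Sub 16 14 15, Sub 16 16 1, Jump_pos 69 16, Jump_pos 84 1,
     Sub 16 4 12, Jump_pos 72 16, Jump_pos 84 1,
     Const 16 (- 1), Jump_pos 77 1,
     Jump_pos 76 12, Jump_pos 84 1,
     Const 16 1,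
     Add 14 14 16, Sub 15 15 16, Sub 12 12 16, Store 10 14, Store 11 15, Store 13 12, Jump_pos 51 1,
     Add 7 13 1, Jump_pos 52 1,
     \<comment> \<open>86: accept if some slack is not positive\<close>
     Add 9 2 0, Jump_pos 93 1,
     Add 10 8 9, Load 11 10, Jump_pos 92 11, Accept,
     Sub 9 9 1,
     Jump_pos 88 9, Reject]"

text \<open>Unfolding turns a program text into one equation \<open>P ! l = ins\<close> per
  instruction, so that fetching becomes rewriting.\<close>

primrec listed :: "program \<Rightarrow> nat \<Rightarrow> program \<Rightarrow> bool" where
  "listed P l [] \<longleftrightarrow> True"
| "listed P l (ins # Q) \<longleftrightarrow> P ! l = ins \<and> listed P (l + 1) Q"

lemma listed_drop: "listed P l (drop l P)"
proof (induction "length P - l" arbitrary: l)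
  case (Suc m)
  then have "l < length P" by simp
  with Suc show ?case by (simp add: Cons_nth_drop_Suc[symmetric])
qed simp

lemma listed_eq: "P = Q \<Longrightarrow> listed P 0 Q"
  using listed_drop[of P 0] by simp

lemmas fetch = listed_eq[OF prog_def,
    unfolded listed.simps add_0 one_add_one numeral_plus_one add_num_simps HOL.simp_thms]

definition dec :: "nat \<Rightarrow> nat \<Rightarrow> (nat \<Rightarrow> int) \<Rightarrow> int list \<Rightarrow> bool \<Rightarrow> bool" where
  "dec = decides prog"

lemma length_prog: "length prog = 95"
  by (simp add: prog_def)

text \<open>One step with the instruction as an argument: once it is fetched, exactly one equation
  applies.\<close>

fun dec_after :: "instr \<Rightarrow> nat \<Rightarrow> nat \<Rightarrow> (nat \<Rightarrow> int) \<Rightarrow> int list \<Rightarrow> bool \<Rightarrow> bool" where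
  "dec_after (Const i x) k l r xs b = dec k (Suc l) (r(i := x)) xs b"
| "dec_after (Add i j m) k l r xs b = dec k (Suc l) (r(i := r j + r m)) xs b"
| "dec_after (Sub i j m) k l r xs b = dec k (Suc l) (r(i := r j - r m)) xs b"
| "dec_after (Load i j) k l r xs b = (0 \<le> r j \<and> dec k (Suc l) (r(i := r (nat (r j)))) xs b)"
| "dec_after (Store i j) k l r xs b = (0 \<le> r i \<and> dec k (Suc l) (r(nat (r i) := r j)) xs b)"
| "dec_after (Jump_pos m j) k l r xs b =
     (if 0 < r j then dec k m r xs b else dec k (Suc l) r xs b)"
| "dec_after (Read i) k l r xs b =
     (case xs of [] \<Rightarrow> False | x # ys \<Rightarrow> dec k (Suc l) (r(i := x)) ys b)"
| "dec_after Accept k l r xs b = b"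
| "dec_after Reject k l r xs b = (\<not> b)"

lemma dec_Suc: "dec (Suc k) l r xs b \<longleftrightarrow> l < 95 \<and> dec_after (prog ! l) k l r xs b"
  by (cases "prog ! l") (simp_all add: dec_def length_prog split: list.split)

text \<open>A budget \<open>k + 5\<close> with a variable \<open>k\<close> allows five steps to be
  rewritten; then the run is blocked at \<open>dec k\<close>. Straight-line pieces of the program
  are verified in this form.\<close>

lemmas dec_numeral =
  dec_Suc[of "k + pred_numeral v" for k v, folded add_Suc_right numeral_eq_Suc]

lemmas dec_mono = decides_mono[of prog, folded dec_def]

lemma nat_numeral_int: "nat (numeral w + int q) = numeral w + q"
  by (simp add: nat_add_distrib)

lemmas run = dec_numeral dec_Suc fetch nat_numeral_int

section \<open>Verification of the loops\<close>

text \<open>The loop counts down and is entered at its test at address 93, so \<open>i\<close>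
  machines are still to be checked. A machine with positive slack costs five steps.\<close>

lemma check_loop:
  assumes "r 0 = 0" "r 1 = 1" "r 8 = 20" "r 9 = int i" "b \<longleftrightarrow> (\<exists>k\<in>{1..i}. r (20 + k) \<le> 0)"
  shows "dec (6 * i + 2) 93 r xs b"
  using assms
proof (induction i arbitrary: r)
  case 0
  then show ?case by (simp add: run)
next
  case (Suc i)
  let ?r = "r(10 := 21 + int i, 11 := r (21 + i), 9 := int i)"
  have b: "b \<longleftrightarrow> r (21 + i) \<le> 0 \<or> (\<exists>k\<in>{1..i}. r (20 + k) \<le> 0)"
    using Suc.prems(5) by (simp add: atLeastAtMostSuc_conv)
  show ?case
  proof (cases "r (21 + i) \<le> 0")
    case True
    have "dec (k + 6) 93 r xs b" for k
      using Suc.prems(1-4) b True by (simp add: run)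
    from this[of "6 * i"] show ?thesis by (rule dec_mono) simp
  next
    case False
    have "dec (6 * i + 2) 93 ?r xs b"
      by (rule Suc.IH) (use Suc.prems b False in simp_all)
    moreover have "dec k 93 ?r xs b \<Longrightarrow> dec (k + 5) 93 r xs b" for k
      using Suc.prems(1-4) False by (simp add: run)
    ultimately have "dec ((6 * i + 2) + 5) 93 r xs b" by blast
    then show ?thesis by (rule dec_mono) simp
  qed
qed

lemma check:
  assumes "r 0 = 0" "r 1 = 1" "r 2 = int n" "r 8 = 20" "b \<longleftrightarrow> (\<exists>k\<in>{1..n}. r (20 + k) \<le> 0)"
  shows "dec (6 * n + 4) 86 r xs b"
proof -
  have "dec (6 * n + 2) 93 (r(9 := int n)) xs b"
    by (rule check_loop) (use assms in simp_all)
  moreover have "dec k 93 (r(9 := int n)) xs b \<Longrightarrow> dec (k + 2) 86 r xs b" for k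
    using assms(1-4) by (simp add: run)
  ultimately have "dec ((6 * n + 2) + 2) 86 r xs b" by blast
  then show ?thesis by (rule dec_mono) simp
qed

section \<open>Balancing\<close>

text \<open>\<open>d\<close> is not tied to \<open>x\<close> here: a move rewrites both, and
  \<open>slack_move\<close> then shows that \<open>d\<close> is again the slack of
  \<open>x\<close>.\<close>

definition represents ::
    "nat \<Rightarrow> nat \<Rightarrow> (nat \<times> nat) list \<Rightarrow> (nat \<Rightarrow> int) \<Rightarrow> (nat \<Rightarrow> int) \<Rightarrow> (nat \<Rightarrow> int) \<Rightarrow> bool" where
  "represents n K es d x r \<longleftrightarrow>
     r 0 = 0 \<and> r 1 = 1 \<and> r 2 = int n \<and> r 4 = int K \<and> r 5 = int (21 + n + 3 * length es) \<and>
     r 6 = int (21 + n) \<and> r 8 = 20 \<and> (\<forall>i\<in>{1..n}. r (20 + i) = d i) \<and>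
     (\<forall>e<length es. r (21 + n + 3 * e) = int (20 + fst (es ! e)) \<and>
                    r (22 + n + 3 * e) = int (20 + snd (es ! e)) \<and>
                    r (23 + n + 3 * e) = x e)"

text \<open>Registers 3, 7 and 9 to 19 hold no part of the distribution.\<close>

lemma represents_scratch:
  assumes "represents n K es d x r" "i = 3 \<or> 6 < i \<and> i < 20 \<and> i \<noteq> 8"
  shows "represents n K es d x (r(i := v))"
proof -
  have "0 \<noteq> i" "1 \<noteq> i" "2 \<noteq> i" "4 \<noteq> i" "5 \<noteq> i" "6 \<noteq> i" "8 \<noteq> i" "20 + m \<noteq> i"
    "21 + n + m \<noteq> i" "22 + n + m \<noteq> i" "23 + n + m \<noteq> i" for m
    using assms(2) by auto
  then show ?thesis
    using assms(1) unfolding represents_def by (simp only: fun_upd_apply if_False) blast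
qed

lemma represents_move:
  assumes "represents n K es d x r" "e < length es" "a \<in> {1..n}" "b \<in> {1..n}" "a \<noteq> b"
  shows "represents n K es (d(a := u, b := v)) (x(e := w)) (r(20 + a := u, 20 + b := v, 23 + n + 3 * e := w))"
proof -
  have "23 + n + 3 * f \<noteq> 23 + n + 3 * e" if "f \<noteq> e" for f using that by simp
  \<comment> \<open>Residues modulo 3 separate the third cell of an edge from the first two cells of
    every edge.\<close>
  moreover have "21 + n + 3 * f \<noteq> 23 + n + 3 * e" "22 + n + 3 * f \<noteq> 23 + n + 3 * e" for f by presburger+
  ultimately show ?thesis using assms by (auto simp: represents_def)
qed

lemma load_edge:
  assumes "r 1 = 1" "r 5 = 21 + int q + t" "0 < t" "r 7 = 21 + int q"
    "r (21 + q) = 20 + int a" "r (22 + q) = 20 + int a'"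
    "dec k 62 (r(9 := t, 10 := 20 + int a, 11 := 20 + int a', 13 := 23 + int q, 12 := r (23 + q),
                 14 := r (20 + a), 15 := r (20 + a'))) xs b"
  shows "dec (k + 9) 52 r xs b"
  using assms by (simp add: run)

text \<open>The slacks at the two ends are \<open>r 14\<close> and \<open>r 15\<close>, with
  \<open>r 12\<close> units at the first end. The five paths are: shift a unit to the second end, no
  unit available for this, shift a unit to the first end, none available, and slacks that differ by
  at most 1. The added numbers are the lengths of the paths.\<close>

lemma balance_cases:
  assumes "r 1 = 1" "r 10 = 20 + int a" "r 11 = 20 + int a'" "r 13 = 23 + int q"
  defines "r' \<equiv> \<lambda>\<delta>. r(16 := \<delta>, 14 := r 14 + \<delta>, 15 := r 15 - \<delta>, 12 := r 12 - \<delta>,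
    20 + a := r 14 + \<delta>, 20 + a' := r 15 - \<delta>, 23 + q := r 12 - \<delta>)"
  shows "r 14 + 2 \<le> r 15 \<Longrightarrow> 0 < r 12 \<Longrightarrow> dec k 51 (r' 1) xs b \<Longrightarrow> dec (k + 12) 62 r xs b"
    and "r 14 + 2 \<le> r 15 \<Longrightarrow> \<not> 0 < r 12 \<Longrightarrow> dec k 84 (r(16 := r 15 - r 14 - 1)) xs b \<Longrightarrow> dec (k + 5) 62 r xs b"
    and "r 15 + 2 \<le> r 14 \<Longrightarrow> r 12 < r 4 \<Longrightarrow> dec k 51 (r' (- 1)) xs b \<Longrightarrow> dec (k + 17) 62 r xs b"
    and "r 15 + 2 \<le> r 14 \<Longrightarrow> \<not> r 12 < r 4 \<Longrightarrow> dec k 84 (r(16 := r 4 - r 12)) xs b \<Longrightarrow> dec (k + 9) 62 r xs b"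
    and "\<not> r 14 + 2 \<le> r 15 \<Longrightarrow> \<not> r 15 + 2 \<le> r 14 \<Longrightarrow> dec k 84 (r(16 := r 14 - r 15 - 1)) xs b \<Longrightarrow> dec (k + 7) 62 r xs b"
proof -
  show "r 14 + 2 \<le> r 15 \<Longrightarrow> 0 < r 12 \<Longrightarrow> dec k 51 (r' 1) xs b \<Longrightarrow> dec (k + 12) 62 r xs b"
    using assms(1-4) unfolding r'_def by (simp add: run)
  show "r 14 + 2 \<le> r 15 \<Longrightarrow> \<not> 0 < r 12 \<Longrightarrow> dec k 84 (r(16 := r 15 - r 14 - 1)) xs b \<Longrightarrow> dec (k + 5) 62 r xs b"
    using assms(1-4) by (simp add: run)
  show "r 15 + 2 \<le> r 14 \<Longrightarrow> r 12 < r 4 \<Longrightarrow> dec k 51 (r' (- 1)) xs b \<Longrightarrow> dec (k + 17) 62 r xs b"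
    using assms(1-4) unfolding r'_def by (simp add: run)
  show "r 15 + 2 \<le> r 14 \<Longrightarrow> \<not> r 12 < r 4 \<Longrightarrow> dec k 84 (r(16 := r 4 - r 12)) xs b \<Longrightarrow> dec (k + 9) 62 r xs b"
    using assms(1-4) by (simp add: run)
  show "\<not> r 14 + 2 \<le> r 15 \<Longrightarrow> \<not> r 15 + 2 \<le> r 14 \<Longrightarrow> dec k 84 (r(16 := r 14 - r 15 - 1)) xs b \<Longrightarrow> dec (k + 7) 62 r xs b"
    using assms(1-4) by (simp add: run)
qed

text \<open>Lexicographic descent: a move lowers the energy and restarts the scan, a balanced edge
  advances \<open>e\<close>. The factor \<open>length es + 1\<close> exceeds every possible
  \<open>length es - e\<close>, so one number measures both. Edges before \<open>e\<close> are
  balanced, hence all edges are when the scan ends.\<close>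

lemma balance_loop:
  assumes es: "\<And>e. e < length es \<Longrightarrow> fst (es ! e) \<in> {1..n} \<and> snd (es ! e) \<in> {1..n} \<and> fst (es ! e) \<noteq> snd (es ! e)"
    and answer: "\<And>x. (\<And>e. e < length es \<Longrightarrow> 0 \<le> x e \<and> x e \<le> int K) \<Longrightarrow>
      (\<And>e. e < length es \<Longrightarrow> balanced_at K es x (slack K es c x) e) \<Longrightarrow>
      (\<exists>i\<in>{1..n}. slack K es c x i \<le> 0) \<longleftrightarrow> b"
    and "represents n K es (slack K es c x) x r" "r 7 = int (21 + n + 3 * e)" "e \<le> length es"
    and "\<And>e. e < length es \<Longrightarrow> 0 \<le> x e \<and> x e \<le> int K"
    and "\<And>f. f < e \<Longrightarrow> balanced_at K es x (slack K es c x) f"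
  shows "dec (30 * (energy n (slack K es c x) * (length es + 1) + (length es - e)) + (6 * n + 7)) 52 r xs b"
  using assms(3-)
proof (induction "energy n (slack K es c x) * (length es + 1) + (length es - e)" arbitrary: x r e rule: less_induct)
  case less
  let ?E = "length es" and ?d = "slack K es c x"
  let ?m = "energy n ?d * (?E + 1) + (?E - e)"
  note rep = less.prems(1)
  have r: "r 0 = 0" "r 1 = 1" "r 2 = int n" "r 4 = int K" "r 5 = int (21 + n + 3 * ?E)" "r 6 = int (21 + n)" "r 8 = 20"
    "\<And>i. i \<in> {1..n} \<Longrightarrow> r (20 + i) = ?d i"
    using rep by (auto simp: represents_def)
  show ?case
  proof (cases "e = ?E")
    case True
    have "(\<exists>i\<in>{1..n}. r (20 + i) \<le> 0) \<longleftrightarrow> (\<exists>i\<in>{1..n}. ?d i \<le> 0)" using r(8) by simp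
    also have "\<dots> \<longleftrightarrow> b" using less.prems(4,5) True by (intro answer) auto
    finally have "dec (6 * n + 4) 86 (r(9 := 0)) xs b"
      using r by (intro check) auto
    moreover have "dec k 86 (r(9 := 0)) xs b \<Longrightarrow> dec (k + 3) 52 r xs b" for k
      using r(1-7) less.prems(2) True by (simp add: run)
    ultimately have "dec ((6 * n + 4) + 3) 52 r xs b" by blast
    then show ?thesis by (rule dec_mono) simp
  next
    case False
    then have e: "e < ?E" using less.prems(3) by simp
    define q where "q = n + 3 * e"
    obtain a a' where aa: "es ! e = (a, a')" by fastforce
    have a: "a \<in> {1..n}" "a' \<in> {1..n}" "a \<noteq> a'" using es[OF e] aa by auto
    have q: "r 7 = 21 + int q" "r (21 + q) = 20 + int a" "r (22 + q) = 20 + int a'" "r (23 + q) = x e"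
      using rep e aa less.prems(2) by (auto simp: represents_def q_def add.assoc)
    have da: "r (20 + a) = ?d a" "r (20 + a') = ?d a'" using r(8) a by auto
    \<comment> \<open>The budget for everything after the current round, which may itself use 30
      steps.\<close>
    let ?k = "30 * (?m - 1) + (6 * n + 7)"
    have IH: "dec ?k 52 r' xs b"
      if "energy n (slack K es c x') * (?E + 1) + (?E - f) < ?m"
        "represents n K es (slack K es c x') x' r'" "r' 7 = int (21 + n + 3 * f)" "f \<le> ?E"
        "\<And>e. e < ?E \<Longrightarrow> 0 \<le> x' e \<and> x' e \<le> int K"
        "\<And>g. g < f \<Longrightarrow> balanced_at K es x' (slack K es c x') g" for x' r' f
    proof (rule dec_mono[OF less.hyps[OF that]])
      have "30 * u + v \<le> 30 * (w - 1) + v" if "u < w" for u v w :: nat using that by linarith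
      from this[OF that(1)]
      show "30 * (energy n (slack K es c x') * (?E + 1) + (?E - f)) + (6 * n + 7) \<le> ?k" .
    qed
    have finish: ?thesis if "dec (?k + 30) 52 r xs b"
      using that by (rule dec_mono) (use e in simp)
    have skip: "dec (?k + 2) 84 r' xs b"
      if r': "r' 13 = 23 + int q" "represents n K es ?d x r'" and bal: "balanced_at K es x ?d e" for r'
    proof -
      have "dec ?k 52 (r'(7 := 24 + int q)) xs b"
      proof (rule IH[where f = "Suc e" and x' = x])
        show "energy n ?d * (?E + 1) + (?E - Suc e) < ?m" using e by simp
        show "balanced_at K es x ?d g" if "g < Suc e" for g
          using that less.prems(5) bal less_Suc_eq by blast
      qed (use r' e less.prems(4) in \<open>auto simp: q_def intro: represents_scratch\<close>)
      moreover have "r' 1 = 1" using r'(2) by (simp add: represents_def)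
      then have "dec k 52 (r'(7 := 24 + int q)) xs b \<Longrightarrow> dec (k + 2) 84 r' xs b" for k
        using r'(1) by (simp add: run)
      ultimately show ?thesis by blast
    qed
    have move: "dec (?k + 1) 51 r' xs b"
      if rep': "represents n K es (?d(a := ?d a + \<delta>, a' := ?d a' - \<delta>)) (x(e := x e - \<delta>)) r'"
        and \<delta>: "?d a + 2 \<le> ?d a' \<and> \<delta> = 1 \<and> 0 < x e \<or> ?d a' + 2 \<le> ?d a \<and> \<delta> = - 1 \<and> x e < int K" for r' \<delta>
    proof -
      have sl: "?d(a := ?d a + \<delta>, a' := ?d a' - \<delta>) = slack K es c (x(e := x e - \<delta>))" (is "?d' = _")
        using slack_move[OF e] aa a(3) by simp
      have less_energy: "energy n ?d' < energy n ?d" using a \<delta> by (intro energy_move) auto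
      \<comment> \<open>One unit of energy pays for the whole restarted scan.\<close>
      have "energy n ?d' * (?E + 1) + ?E < (energy n ?d' + 1) * (?E + 1)" by simp
      also have "\<dots> \<le> energy n ?d * (?E + 1)" using less_energy by (intro mult_right_mono) auto
      finally have m: "energy n ?d' * (?E + 1) + (?E - 0) < ?m" by simp
      have "dec ?k 52 (r'(7 := 21 + int n)) xs b"
      proof (rule IH[where f = 0 and x' = "x(e := x e - \<delta>)"])
        show "energy n (slack K es c (x(e := x e - \<delta>))) * (?E + 1) + (?E - 0) < ?m" using m by (simp only: sl)
        show "represents n K es (slack K es c (x(e := x e - \<delta>))) (x(e := x e - \<delta>)) (r'(7 := 21 + int n))"
          unfolding sl[symmetric] by (intro represents_scratch rep') simp
        show "0 \<le> (x(e := x e - \<delta>)) f \<and> (x(e := x e - \<delta>)) f \<le> int K" if "f < ?E" for f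
          using less.prems(4)[OF e] less.prems(4)[OF that] \<delta> by auto
      qed auto
      moreover have "r' 0 = 0" "r' 6 = 21 + int n" using rep' by (simp_all add: represents_def)
      then have "dec k 52 (r'(7 := 21 + int n)) xs b \<Longrightarrow> dec (k + 1) 51 r' xs b" for k
        by (simp add: run)
      ultimately show ?thesis by blast
    qed
    let ?r = "r(9 := 3 * int (?E - e), 10 := 20 + int a, 11 := 20 + int a', 13 := 23 + int q, 12 := x e, 14 := ?d a, 15 := ?d a')"
    have load: "dec k 62 ?r xs b \<Longrightarrow> dec (k + 9) 52 r xs b" for k
      by (rule load_edge[where q = q and a = a and a' = a'])
        (use r(2,5) q da a e in \<open>simp_all add: q_def of_nat_diff\<close>)
    have 62: ?thesis if "dec (?k + 20) 62 ?r xs b"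
      using load[OF that] by (intro finish) (rule dec_mono, assumption, simp)
    have scratch: "represents n K es ?d x ?r" "represents n K es ?d x (?r(16 := v))" for v
      by (intro represents_scratch rep; simp)+
    have skip': "dec (?k + 2) 84 (?r(16 := v)) xs b" if "balanced_at K es x ?d e" for v
      by (intro skip scratch that) simp
    have addr: "23 + q = 23 + n + 3 * e" by (simp add: q_def)
    have move': "dec (?k + 1) 51 (?r(16 := \<delta>, 14 := ?d a + \<delta>, 15 := ?d a' - \<delta>, 12 := x e - \<delta>,
        20 + a := ?d a + \<delta>, 20 + a' := ?d a' - \<delta>, 23 + q := x e - \<delta>)) xs b"
      if "?d a + 2 \<le> ?d a' \<and> \<delta> = 1 \<and> 0 < x e \<or> ?d a' + 2 \<le> ?d a \<and> \<delta> = - 1 \<and> x e < int K" for \<delta>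
      unfolding addr
    proof (rule move[OF _ that], rule represents_move)
      show "represents n K es ?d x (?r(16 := \<delta>, 14 := ?d a + \<delta>, 15 := ?d a' - \<delta>, 12 := x e - \<delta>))"
        by (rule represents_scratch, rule represents_scratch, rule represents_scratch, rule scratch(2)) simp_all
    qed (use a e in simp_all)
    have m1: "dec ((?k + 1) + 12) 62 ?r xs b" if "?d a + 2 \<le> ?d a'" "0 < x e"
      by (rule balance_cases(1)[of _ a a' q]) (use r(2) that move'[of 1] in simp_all)
    have m2: "dec ((?k + 1) + 17) 62 ?r xs b" if "?d a' + 2 \<le> ?d a" "x e < int K"
      by (rule balance_cases(3)[of _ a a' q]) (use r(2,4) that move'[of "- 1"] in simp_all)
    show ?thesis
    proof (rule 62, cases "balanced_at K es x ?d e")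
      case True
      have s1: "dec ((?k + 2) + 5) 62 ?r xs b" if "?d a + 2 \<le> ?d a'" "\<not> 0 < x e"
        by (rule balance_cases(2)[of _ a a' q]) (use r(2) that skip'[OF True] in simp_all)
      have s2: "dec ((?k + 2) + 9) 62 ?r xs b" if "?d a' + 2 \<le> ?d a" "\<not> x e < int K"
        by (rule balance_cases(4)[of _ a a' q]) (use r(2,4) that skip'[OF True] in simp_all)
      have s3: "dec ((?k + 2) + 7) 62 ?r xs b" if "\<not> ?d a + 2 \<le> ?d a'" "\<not> ?d a' + 2 \<le> ?d a"
        by (rule balance_cases(5)[of _ a a' q]) (use r(2,4) that skip'[OF True] in simp_all)
      consider "?d a + 2 \<le> ?d a'" "\<not> 0 < x e" | "?d a' + 2 \<le> ?d a" "\<not> x e < int K"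
        | "\<not> ?d a + 2 \<le> ?d a'" "\<not> ?d a' + 2 \<le> ?d a"
        using True unfolding balanced_at_def aa fst_conv snd_conv by linarith
      then show "dec (?k + 20) 62 ?r xs b"
        by cases (drule (1) s1 s2 s3, erule dec_mono, simp)+
    next
      case False
      then consider "?d a + 2 \<le> ?d a'" "0 < x e" | "?d a' + 2 \<le> ?d a" "x e < int K"
        unfolding balanced_at_def aa fst_conv snd_conv by linarith
      then show "dec (?k + 20) 62 ?r xs b"
        by cases (drule (1) m1 m2, erule dec_mono, simp)+
    qed
  qed
qed

section \<open>Reading the jobs\<close>

fun edge_of :: "nat list \<Rightarrow> (nat \<times> nat) list" where
  "edge_of [a, b] = [(a, b)]"
| "edge_of _ = []"

definition encode_job :: "nat list \<Rightarrow> int list" where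
  "encode_job l = int (length l) # map int l"

text \<open>Initially all units of an edge sit at its first end, so a new edge \<open>(a, b)\<close>
  affects only the slack of \<open>a\<close>.\<close>

lemma slack_snoc:
  "slack K (es @ [(a, b)]) c (\<lambda>_. int K) =
     (slack K es c (\<lambda>_. int K))(a := slack K es c (\<lambda>_. int K) a - int K)"
proof
  fix i
  have "(\<Sum>e<length es. units_at K (es @ [(a, b)]) (\<lambda>_. int K) i e) =
      (\<Sum>e<length es. units_at K es (\<lambda>_. int K) i e)"
    by (intro sum.cong) (auto simp: units_at_def nth_append)
  then show "slack K (es @ [(a, b)]) c (\<lambda>_. int K) i =
     ((slack K es c (\<lambda>_. int K))(a := slack K es c (\<lambda>_. int K) a - int K)) i"
    by (simp add: slack_def) (simp add: units_at_def)
qed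

lemma represents_snoc:
  assumes "represents n K es d x r" "a \<in> {1..n}" "u = n + 3 * length es"
  shows "represents n K (es @ [(a, b)]) (d(a := v)) x
    (r(21 + u := 20 + int a, 22 + u := 20 + int b, 23 + u := x (length es), 5 := 24 + int u, 20 + a := v))"
    (is "represents _ _ ?es ?d x ?r")
proof -
  have old: "?r (20 + n + m) = r (20 + n + m)" if "0 < m" "m \<le> 3 * length es" for m
    using that assms(2,3) by simp
  have new: "?r (21 + u) = 20 + int a" "?r (22 + u) = 20 + int b" "?r (23 + u) = x (length es)"
    using assms(2,3) by simp_all
  have "?r (20 + i) = ?d i" if "i \<in> {1..n}" for i
    using that assms by (auto simp: represents_def)
  moreover have "?r (21 + n + 3 * e) = int (20 + fst (?es ! e)) \<and> ?r (22 + n + 3 * e) = int (20 + snd (?es ! e)) \<and>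
      ?r (23 + n + 3 * e) = x e" if "e < length ?es" for e
  proof (cases "e = length es")
    case True
    then show ?thesis using new assms(3) by (simp add: add.assoc)
  next
    case False
    then have e: "e < length es" using that by simp
    have "?r (21 + n + 3 * e) = r (21 + n + 3 * e)" "?r (22 + n + 3 * e) = r (22 + n + 3 * e)"
      "?r (23 + n + 3 * e) = r (23 + n + 3 * e)"
      using old[of "1 + 3 * e"] old[of "2 + 3 * e"] old[of "3 + 3 * e"] e
      by (simp_all only: add.assoc[symmetric]) (simp_all add: algebra_simps)
    then show ?thesis using assms(1) e by (simp add: represents_def nth_append)
  qed
  moreover have "?r 0 = r 0" "?r 1 = r 1" "?r 2 = r 2" "?r 4 = r 4" "?r 6 = r 6" "?r 8 = r 8" "?r 5 = 24 + int u"
    using assms(2) by simp_all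
  ultimately show ?thesis using assms(1,3) unfolding represents_def by simp
qed

text \<open>The bounds on \<open>a\<close> keep the slack cell \<open>20 + a\<close> apart from the
  fixed registers and from the new edge cells, so the stores do not interfere.\<close>

lemma read_edge:
  assumes r: "r 0 = 0" "r 1 = 1" "r 8 = 20" "r 9 = 1 + int m" "r 5 = 21 + int u" and a: "1 \<le> a" "a \<le> u"
    and cont: "dec k 50 (r(10 := 20 + int a, 11 := 20 + int b, 21 + u := 20 + int a, 22 + u := 20 + int b, 23 + u := r 4,
      5 := 24 + int u, 12 := r (20 + a) - r 4, 20 + a := r (20 + a) - r 4, 9 := int m)) xs ans"
  shows "dec (k + 18) 50 r (2 # int a # int b # xs) ans"
  using assms by (simp add: run add.commute[of _ 20])

text \<open>\<open>es\<close> holds the edges stored so far, and each job in \<open>ls\<close> adds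
  at most one. The first assumption is the rest of the run with its budget \<open>k\<close>; a job
  takes at most 18 steps.\<close>

lemma jobs_loop:
  assumes "\<And>r. represents n K (es @ concat (map edge_of ls)) (slack K (es @ concat (map edge_of ls)) c (\<lambda>_. int K)) (\<lambda>_. int K) r
      \<Longrightarrow> dec k 51 r xs b"
    and "\<And>l. l \<in> set ls \<Longrightarrow> length l \<le> 2 \<and> set l \<subseteq> {1..n}"
    and "represents n K es (slack K es c (\<lambda>_. int K)) (\<lambda>_. int K) r" "r 9 = int (length ls)"
  shows "dec (k + 18 * length ls + 1) 50 r (concat (map encode_job ls) @ xs) b"
  using assms
proof (induction ls arbitrary: es r)
  case Nil
  have "dec k 51 r xs b" using Nil by simp
  then show ?case using Nil(4) by (simp add: run)
next
  case (Cons l ls)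
  note rep = Cons.prems(3)
  have r: "r 0 = 0" "r 1 = 1" "r 4 = int K" "r 8 = 20" "r 5 = 21 + int (n + 3 * length es)"
    "r 9 = 1 + int (length ls)"
    using rep Cons.prems(4) by (simp_all add: represents_def)
  let ?xs = "concat (map encode_job ls) @ xs" and ?k = "k + 18 * length ls + 1"
  have IH: "dec ?k 50 r' ?xs b"
    if "represents n K (es @ edge_of l) (slack K (es @ edge_of l) c (\<lambda>_. int K)) (\<lambda>_. int K) r'" "r' 9 = int (length ls)" for r'
    using Cons.prems(1,2) that by (intro Cons.IH[where es = "es @ edge_of l"]) simp_all
  have "length l \<le> 2" using Cons.prems(2)[of l] by simp
  then consider "l = []" | a where "l = [a]" | a a' where "l = [a, a']"
    by (cases l rule: edge_of.cases) auto
  then have "dec (?k + 18) 50 r (encode_job l @ ?xs) b"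
  proof cases
    case 1
    have "dec (m + 7) 50 r (0 # ?xs) b" if "dec m 50 (r(10 := 0, 11 := - 1, 9 := int (length ls))) ?xs b" for m
      using that r by (simp add: run)
    moreover have "dec ?k 50 (r(10 := 0, 11 := - 1, 9 := int (length ls))) ?xs b"
      using rep 1 by (intro IH represents_scratch) simp_all
    ultimately have "dec (?k + 7) 50 r (0 # ?xs) b" by blast
    then show ?thesis using 1 by (auto simp: encode_job_def elim: dec_mono)
  next
    case (2 a)
    have "dec (m + 8) 50 r (1 # int a # ?xs) b" if "dec m 50 (r(11 := 0, 10 := int a, 9 := int (length ls))) ?xs b" for m
      using that r by (simp add: run fun_upd_twist)
    moreover have "dec ?k 50 (r(11 := 0, 10 := int a, 9 := int (length ls))) ?xs b"
      using rep 2 by (intro IH represents_scratch) simp_all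
    ultimately have "dec (?k + 8) 50 r (1 # int a # ?xs) b" by blast
    then show ?thesis using 2 by (auto simp: encode_job_def elim: dec_mono)
  next
    case (3 a a')
    let ?u = "n + 3 * length es" and ?d = "slack K es c (\<lambda>_. int K)"
    have a: "a \<in> {1..n}" using Cons.prems(2)[of l] 3 by simp
    have d: "r (20 + a) = ?d a" using rep a by (simp add: represents_def)
    let ?r = "r(10 := 20 + int a, 11 := 20 + int a')"
    have "represents n K (es @ [(a, a')]) (?d(a := ?d a - int K)) (\<lambda>_. int K)
      (?r(12 := ?d a - int K, 21 + ?u := 20 + int a, 22 + ?u := 20 + int a', 23 + ?u := int K, 5 := 24 + int ?u, 20 + a := ?d a - int K))"
      using rep a by (intro represents_snoc represents_scratch) simp_all
    then have "represents n K (es @ edge_of l) (slack K (es @ edge_of l) c (\<lambda>_. int K)) (\<lambda>_. int K)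
      (?r(12 := ?d a - int K, 21 + ?u := 20 + int a, 22 + ?u := 20 + int a', 23 + ?u := int K, 5 := 24 + int ?u, 20 + a := ?d a - int K,
         9 := int (length ls)))"
      by (intro represents_scratch[of _ _ _ _ _ _ 9]) (simp_all add: 3 slack_snoc)
    then have "dec ?k 50 (?r(12 := ?d a - int K, 21 + ?u := 20 + int a, 22 + ?u := 20 + int a', 23 + ?u := int K, 5 := 24 + int ?u, 20 + a := ?d a - int K,
         9 := int (length ls))) ?xs b"
      by (rule IH) simp
    moreover have "?r(12 := ?d a - int K, 21 + ?u := 20 + int a, 22 + ?u := 20 + int a', 23 + ?u := int K, 5 := 24 + int ?u, 20 + a := ?d a - int K,
         9 := int (length ls)) = ?r(21 + ?u := 20 + int a, 22 + ?u := 20 + int a', 23 + ?u := r 4,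
      5 := 24 + int ?u, 12 := r (20 + a) - r 4, 20 + a := r (20 + a) - r 4, 9 := int (length ls))"
      using r(3) d by (auto simp: fun_eq_iff)
    ultimately have "dec (?k + 18) 50 r (2 # int a # int a' # ?xs) b"
      using r a by (intro read_edge[where u = ?u and m = "length ls"]) simp_all
    then show ?thesis using 3 by (simp add: encode_job_def)
  qed
  then have "dec (k + 18 * length (l # ls) + 1) 50 r (encode_job l @ ?xs) b" by (rule dec_mono) simp
  then show ?case by (simp only: list.map concat.simps append_assoc)
qed

section \<open>Reading the capacities and squaring\<close>

text \<open>Repeated addition stops as soon as one of the counters \<open>c\<close> and
  \<open>t\<close> is used up. So even an exponentially large capacity costs at most
  \<open>t\<close> rounds. The final counter values \<open>u\<close> and \<open>v\<close> do not
  matter to the rest of the run.\<close>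

lemma capacity_loop:
  assumes "\<And>u v. dec k 22 (r(10 := u, 11 := v, 12 := r 12 + r 4 * int (min c t))) xs b"
    and "r 1 = 1" "r 10 = int c" "r 11 = int t"
  shows "dec (k + 5 * t + 2) 19 r xs b"
  using assms
proof (induction t arbitrary: r c)
  case 0
  have "r(10 := r 10, 11 := r 11, 12 := r 12 + r 4 * int (min c 0)) = r" by simp
  then have "dec k 22 r xs b" using 0(1)[of "r 10" "r 11"] by (simp only:)
  then show ?case using 0(2-) by (cases "0 < c") (simp_all add: run)
next
  case (Suc t)
  show ?case
  proof (cases "c = 0")
    case True
    note 0 = this
    have "r(10 := r 10, 11 := r 11, 12 := r 12 + r 4 * int (min c (Suc t))) = r" using 0 by simp
    then have "dec k 22 r xs b" using Suc.prems(1)[of "r 10" "r 11"] by (simp only:)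
    moreover have "dec (m + 2) 19 r xs b" if "dec m 22 r xs b" for m
      using that Suc.prems(2-) 0 by (simp add: run)
    ultimately have "dec (k + 2) 19 r xs b" by blast
    then show ?thesis by (rule dec_mono) simp
  next
    case False
    then obtain c' where c': "c = Suc c'" by (cases c) auto
    let ?r = "r(12 := r 12 + r 4, 10 := int c', 11 := int t)"
    have "dec (k + 5 * t + 2) 19 ?r xs b"
    proof (rule Suc.IH)
      fix u v
      have "?r(10 := u, 11 := v, 12 := ?r 12 + ?r 4 * int (min c' t)) =
        r(10 := u, 11 := v, 12 := r 12 + r 4 * int (min c (Suc t)))"
        using c' by (auto simp: fun_eq_iff algebra_simps)
      then show "dec k 22 (?r(10 := u, 11 := v, 12 := ?r 12 + ?r 4 * int (min c' t))) xs b"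
        using Suc.prems(1)[of u v] by (simp only:)
    qed (use Suc.prems(2) in simp_all)
    moreover have "dec (m + 5) 19 r xs b" if "dec m 19 ?r xs b" for m
      using that Suc.prems(2-) c' by (simp add: run)
    ultimately have "dec (k + 5 * t + 2 + 5) 19 r xs b" by blast
    then show ?thesis by (rule dec_mono) simp
  qed
qed

lemma capacities_loop:
  assumes "\<And>r. r 0 = 0 \<Longrightarrow> r 1 = 1 \<Longrightarrow> r 2 = int n \<Longrightarrow> r 3 = int J \<Longrightarrow> r 4 = int K \<Longrightarrow> r 5 = 21 + int n \<Longrightarrow> r 8 = 20 \<Longrightarrow>
      (\<And>i. i \<in> {1..n} \<Longrightarrow> r (20 + i) = int K * int (min (c i) (J + 1))) \<Longrightarrow> dec k 26 r xs b"
    and "r 0 = 0" "r 1 = 1" "r 2 = int n" "r 3 = int J" "r 4 = int K" "r 5 = 21 + int m" "r 8 = 20" "m \<le> n"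
    and "\<And>i. i \<in> {1..m} \<Longrightarrow> r (20 + i) = int K * int (min (c i) (J + 1))" "r 9 = int (n - m)"
  shows "dec (k + (5 * J + 20) * (n - m) + 1) 25 r (map (\<lambda>i. int (c i)) [Suc m..<Suc n] @ xs) b"
  using assms
proof (induction "n - m" arbitrary: m r)
  case 0
  then have "m = n" by simp
  then have "dec k 26 r xs b" using 0 by simp
  then show ?case using 0(12) \<open>m = n\<close> by (simp add: run)
next
  case (Suc t)
  then have m: "m < n" "n - Suc m = t" by simp_all
  let ?xs = "map (\<lambda>i. int (c i)) [Suc (Suc m)..<Suc n] @ xs" and ?k = "k + (5 * J + 20) * t + 1"
  have xs: "map (\<lambda>i. int (c i)) [Suc m..<Suc n] @ xs = int (c (Suc m)) # ?xs"
    using m by (simp add: upt_conv_Cons del: upt_Suc)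
  let ?v = "int K * int (min (c (Suc m)) (J + 1))"
  have IH: "dec ?k 25 (r(10 := u, 11 := v, 12 := ?v, 21 + m := ?v, 5 := 22 + int m, 9 := int t)) ?xs b" (is "dec _ _ ?r _ _") for u v
  proof -
    have "?r (20 + i) = int K * int (min (c i) (J + 1))" if "i \<in> {1..Suc m}" for i
    proof (cases "i = Suc m")
      case False
      then show ?thesis using that Suc.prems(10)[of i] by simp
    qed simp
    then have "dec (k + (5 * J + 20) * (n - Suc m) + 1) 25 ?r ?xs b"
      by (intro Suc.hyps(1)[OF _ Suc.prems(1)]) (use Suc.prems(2-8) m in simp_all)
    then show ?thesis by (simp only: m)
  qed
  have 22: "dec (j + 3) 22 s ?xs b"
    if "dec j 25 (s(21 + m := s 12, 5 := 22 + int m, 9 := s 9 - 1)) ?xs b" "s 1 = 1" "s 5 = 21 + int m" for j s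
    using that by (simp add: run del: upt_Suc)
  have "dec (?k + 3 + 5 * (J + 1) + 2) 19 (r(10 := int (c (Suc m)), 11 := int (J + 1), 12 := 0)) ?xs b"
  proof (rule capacity_loop)
    fix u v
    let ?s = "r(10 := int (c (Suc m)), 11 := int (J + 1), 12 := 0)"
    let ?s' = "?s(10 := u, 11 := v, 12 := ?s 12 + ?s 4 * int (min (c (Suc m)) (J + 1)))"
    have eq: "?s' = r(10 := u, 11 := v, 12 := ?v)" using Suc.prems(6) by auto
    have "r 9 - 1 = int t" using Suc.prems(11) Suc.hyps(2) by simp
    then show "dec (?k + 3) 22 ?s' ?xs b"
      unfolding eq using IH[of u v] Suc.prems(3,7) by (intro 22) simp_all
  qed (use Suc.prems(3) in simp_all)
  moreover have "dec (j + 5) 25 r (int (c (Suc m)) # ?xs) b"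
    if "dec j 19 (r(10 := int (c (Suc m)), 11 := int (J + 1), 12 := 0)) ?xs b" for j
    using that Suc.prems(3,5,11) m(1) by (simp add: run add.commute del: upt_Suc)
  ultimately have "dec (?k + 3 + 5 * (J + 1) + 2 + 5) 25 r (int (c (Suc m)) # ?xs) b" by blast
  then show ?case unfolding xs Suc.hyps(2)[symmetric] by (rule dec_mono) simp
qed

lemma square_loop:
  assumes "dec k 9 (r(4 := r 4 + r 2 * int i, 9 := 0)) xs b" "r 1 = 1" "r 9 = int i"
  shows "dec (k + 3 * i + 1) 8 r xs b"
  using assms
proof (induction i arbitrary: r)
  case 0
  have "r(4 := r 4 + r 2 * int 0, 9 := 0) = r" using 0(3) by auto
  then have "dec k 9 r xs b" using 0(1) by (simp only:)
  then show ?case using 0(2,3) by (simp add: run)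
next
  case (Suc i)
  let ?r = "r(4 := r 4 + r 2, 9 := int i)"
  have eq: "?r(4 := ?r 4 + ?r 2 * int i, 9 := 0) = r(4 := r 4 + r 2 * int (Suc i), 9 := 0)"
    by (auto simp: fun_eq_iff algebra_simps)
  have "dec (k + 3 * i + 1) 8 ?r xs b"
  proof (rule Suc.IH)
    show "dec k 9 (?r(4 := ?r 4 + ?r 2 * int i, 9 := 0)) xs b" unfolding eq by (rule Suc.prems(1))
  qed (use Suc.prems(2) in simp_all)
  moreover have "dec (m + 3) 8 r xs b" if "dec m 8 ?r xs b" for m
    using that Suc.prems(2,3) by (simp add: run)
  ultimately have "dec (k + 3 * i + 1 + 3) 8 r xs b" by blast
  then show ?case by (rule dec_mono) simp
qed

section \<open>The whole program\<close>

text \<open>The budgets of the phases, beginning with the last ones. The leading term bounds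
  balancing: \<open>n * (n * n * (J + 1))\<^sup>2\<close> is the energy bound for
  \<open>K = n * n\<close> and \<open>N = J + 1\<close>, and a scan has at most \<open>J + 1\<close>
  rounds.\<close>

definition step_bound :: "nat \<Rightarrow> nat \<Rightarrow> nat" where
  "step_bound n J = 30 * (n * (n * n * (J + 1))\<^sup>2 * (J + 1) + J) + (6 * n + 7) + 1 + 18 * J + 1 + 3 +
     (5 * J + 20) * n + 1 + 3 + 3 * n + 1 + 6"

lemma length_edges: "length (concat (map edge_of ls)) \<le> length ls"
proof (induction ls)
  case (Cons l ls)
  have "length (edge_of l) \<le> 1" by (cases l rule: edge_of.cases) auto
  with Cons show ?case by simp
qed simp

text \<open>The phases are composed backwards: each intermediate claim is named after its entry
  address, and its budget contains that of everything that follows.\<close>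

lemma program_decides_density:
  fixes ls :: "nat list list" and n :: nat
  defines "es \<equiv> concat (map edge_of ls)"
  assumes ls: "\<And>l. l \<in> set ls \<Longrightarrow> length l \<le> 2 \<and> set l \<subseteq> {1..n}"
    and es: "\<And>e. e < length es \<Longrightarrow> fst (es ! e) \<in> {1..n} \<and> snd (es ! e) \<in> {1..n} \<and> fst (es ! e) \<noteq> snd (es ! e)"
    and b: "b \<longleftrightarrow> (\<exists>B\<subseteq>{1..n}. B \<noteq> {} \<and> (\<Sum>i\<in>B. min (c i) (length ls + 1)) \<le> card (inner_edges es B))"
  shows "dec (step_bound n (length ls)) 0 (\<lambda>_. 0)
    (int n # int (length ls) # map (\<lambda>i. int (c i)) [Suc 0..<Suc n] @ concat (map encode_job ls)) b"
proof -
  let ?J = "length ls" and ?K = "n * n" and ?c = "\<lambda>i. min (c i) (length ls + 1)"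
  let ?x = "\<lambda>_::nat. int (n * n)"
  have len: "length es \<le> ?J" unfolding es_def by (rule length_edges)
  have energy: "energy n (slack ?K es ?c ?x) \<le> n * (?K * (?J + 1))\<^sup>2"
    using len es by (intro energy_bound) auto
  have 51: "dec (30 * (n * (?K * (?J + 1))\<^sup>2 * (?J + 1) + ?J) + (6 * n + 7) + 1) 51 r [] b" (is "dec (?k51 + 1) _ _ _ _")
    if rep: "represents n ?K es (slack ?K es ?c ?x) ?x r" for r
  proof -
    have "dec (30 * (energy n (slack ?K es ?c ?x) * (length es + 1) + (length es - 0)) + (6 * n + 7)) 52 (r(7 := 21 + int n)) [] b"
    proof (rule balance_loop[where c = ?c])
      show "(\<exists>i\<in>{1..n}. slack ?K es ?c x i \<le> 0) \<longleftrightarrow> b"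
        if "\<And>e. e < length es \<Longrightarrow> 0 \<le> x e \<and> x e \<le> int ?K"
          "\<And>e. e < length es \<Longrightarrow> balanced_at ?K es x (slack ?K es ?c x) e" for x
        unfolding b using es that by (intro balanced_decides_density) auto
    qed (use es rep in \<open>auto intro: represents_scratch\<close>)
    moreover have "30 * (energy n (slack ?K es ?c ?x) * (length es + 1) + (length es - 0)) + (6 * n + 7) \<le> ?k51"
      using len energy by (intro add_mono mult_mono) auto
    ultimately have "dec ?k51 52 (r(7 := 21 + int n)) [] b" by (rule dec_mono)
    moreover have "dec (m + 1) 51 r [] b" if "dec m 52 (r(7 := 21 + int n)) [] b" for m
      using that rep by (simp add: run represents_def)
    ultimately show ?thesis by blast
  qed
  have 50: "dec (?k51 + 1 + 18 * ?J + 1) 50 r (concat (map encode_job ls)) b"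
    if "represents n ?K [] (slack ?K [] ?c ?x) ?x r" "r 9 = int ?J" for r
  proof -
    have "dec (?k51 + 1 + 18 * ?J + 1) 50 r (concat (map encode_job ls) @ []) b"
      by (rule jobs_loop[where es = "[]" and c = ?c and K = ?K and n = n])
        (use 51 ls that in \<open>simp_all only: es_def append_Nil\<close>)
    then show ?thesis by (simp only: append_Nil2)
  qed
  have 26: "dec (?k51 + 1 + 18 * ?J + 1 + 3) 26 r (concat (map encode_job ls)) b"
    if r: "r 0 = 0" "r 1 = 1" "r 2 = int n" "r 3 = int ?J" "r 4 = int ?K" "r 5 = 21 + int n" "r 8 = 20"
      "\<And>i. i \<in> {1..n} \<Longrightarrow> r (20 + i) = int ?K * int (min (c i) (?J + 1))" for r
  proof -
    have "represents n ?K [] (slack ?K [] ?c ?x) ?x (r(6 := 21 + int n, 9 := int ?J))"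
      using r unfolding represents_def slack_def by simp
    then have "dec (?k51 + 1 + 18 * ?J + 1) 50 (r(6 := 21 + int n, 9 := int ?J)) (concat (map encode_job ls)) b"
      by (rule 50) simp
    moreover have "dec (m + 3) 26 r xs b" if "dec m 50 (r(6 := 21 + int n, 9 := int ?J)) xs b" for m xs
      using that r(1-7) by (simp add: run)
    ultimately show ?thesis by blast
  qed
  let ?xs = "map (\<lambda>i. int (c i)) [Suc 0..<Suc n] @ concat (map encode_job ls)"
  let ?k25 = "?k51 + 1 + 18 * ?J + 1 + 3 + (5 * ?J + 20) * n + 1"
  have 25: "dec ?k25 25 r ?xs b"
    if "r 0 = 0" "r 1 = 1" "r 2 = int n" "r 3 = int ?J" "r 4 = int ?K" "r 5 = 21" "r 8 = 20" "r 9 = int n" for r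
  proof -
    have "dec (?k51 + 1 + 18 * ?J + 1 + 3 + (5 * ?J + 20) * (n - 0) + 1) 25 r ?xs b"
      by (rule capacities_loop[where K = ?K, OF 26]) (use that in simp_all)
    then show ?thesis by (simp only: diff_zero)
  qed
  let ?r0 = "(\<lambda>_::nat. 0 :: int)(1 := 1, 8 := 20, 2 := int n, 3 := int ?J, 9 := int n)"
  have "dec (?k25 + 3 + 3 * n + 1) 8 ?r0 ?xs b"
  proof (rule square_loop)
    let ?s = "?r0(4 := ?r0 4 + ?r0 2 * int n, 9 := 0)"
    have "dec (m + 3) 9 ?s ?xs b" if "dec m 25 (?s(5 := 21, 9 := int n)) ?xs b" for m
      using that by (simp add: run)
    moreover have "dec ?k25 25 (?s(5 := 21, 9 := int n)) ?xs b" by (rule 25) simp_all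
    ultimately show "dec (?k25 + 3) 9 ?s ?xs b" by blast
  qed simp_all
  moreover have "dec (m + 6) 0 (\<lambda>_. 0) (int n # int ?J # ys) b" if "dec m 8 ?r0 ys b" for m ys
    using that by (simp add: run fetch[unfolded One_nat_def] numeral_2_eq_2[symmetric])
  ultimately have "dec (?k25 + 3 + 3 * n + 1 + 6) 0 (\<lambda>_. 0) (int n # int ?J # ?xs) b" by blast
  then show ?thesis unfolding step_bound_def .
qed

section \<open>From instances to graphs\<close>

definition job_list :: "open_shop \<Rightarrow> nat list list" where
  "job_list S = map (\<lambda>j. sorted_list_of_set (req S j)) [1..<Suc (njobs S)]"

lemma length_job_list [simp]: "length (job_list S) = njobs S"
  by (simp add: job_list_def del: upt_Suc)

lemma set_job_list: "set (job_list S) = (\<lambda>j. sorted_list_of_set (req S j)) ` jobs S"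
  by (simp add: job_list_def jobs_def atLeastLessThanSuc_atLeastAtMost del: upt_Suc)

lemma encode_eq:
  "encode S = int (nmach S) # int (length (job_list S)) #
     map (\<lambda>i. int (cap S i)) [Suc 0..<Suc (nmach S)] @ concat (map encode_job (job_list S))"
  by (simp add: encode_def job_list_def encode_job_def comp_def del: upt_Suc)

lemma edge_of_sorted:
  assumes "finite A"
  shows "e \<in> set (edge_of (sorted_list_of_set A)) \<Longrightarrow> A = {fst e, snd e} \<and> fst e \<noteq> snd e"
    and "length (filter (\<lambda>e. fst e \<in> B \<and> snd e \<in> B) (edge_of (sorted_list_of_set A))) =
      (if card A = 2 \<and> A \<subseteq> B then 1 else 0)"
proof -
  have A: "set (sorted_list_of_set A) = A" "distinct (sorted_list_of_set A)" "length (sorted_list_of_set A) = card A"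
    using assms by simp_all
  then show "e \<in> set (edge_of (sorted_list_of_set A)) \<Longrightarrow> A = {fst e, snd e} \<and> fst e \<noteq> snd e"
    and "length (filter (\<lambda>e. fst e \<in> B \<and> snd e \<in> B) (edge_of (sorted_list_of_set A))) =
      (if card A = 2 \<and> A \<subseteq> B then 1 else 0)"
    by (cases "sorted_list_of_set A" rule: edge_of.cases; auto)+
qed

lemma card_inner_edges: "card (inner_edges es B) = length (filter (\<lambda>e. fst e \<in> B \<and> snd e \<in> B) es)"
  by (simp add: inner_edges_def length_filter_conv_card)

text \<open>Different jobs may need the same two machines, so positions in the edge list are
  counted, not pairs.\<close>

lemma card_two_jobs:
  assumes "\<And>j. j \<in> jobs S \<Longrightarrow> finite (req S j)"
  shows "card (inner_edges (concat (map edge_of (job_list S))) B) = card (two_jobs S B)"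
proof -
  let ?P = "\<lambda>j. card (req S j) = 2 \<and> req S j \<subseteq> B"
  have "length (filter (\<lambda>e. fst e \<in> B \<and> snd e \<in> B) (concat (map (\<lambda>j. edge_of (sorted_list_of_set (req S j))) js))) =
      length (filter ?P js)" if "set js \<subseteq> jobs S" for js
    using that
  proof (induction js)
    case (Cons j js)
    then show ?case using edge_of_sorted(2)[OF assms, of j B] by simp
  qed simp
  from this[of "[1..<Suc (njobs S)]"]
  have "card (inner_edges (concat (map edge_of (job_list S))) B) = length (filter ?P [1..<Suc (njobs S)])"
    by (simp add: card_inner_edges job_list_def comp_def jobs_def atLeastLessThanSuc_atLeastAtMost del: upt_Suc)
  also have "\<dots> = card (set (filter ?P [1..<Suc (njobs S)]))"
    by (rule distinct_card[symmetric]) simp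
  also have "set (filter ?P [1..<Suc (njobs S)]) = two_jobs S B"
    by (auto simp: two_jobs_def jobs_def)
  finally show ?thesis .
qed

text \<open>A set never contains more than \<open>njobs S\<close> jobs, so a machine with truncated
  capacity makes both inequalities fail.\<close>

lemma overcrowded_iff_truncated:
  assumes "\<And>j. j \<in> jobs S \<Longrightarrow> finite (req S j)"
  shows "(\<exists>B. overcrowded S B) \<longleftrightarrow> (\<exists>B\<subseteq>{1..nmach S}. B \<noteq> {} \<and>
    (\<Sum>i\<in>B. min (cap S i) (length (job_list S) + 1)) \<le> card (inner_edges (concat (map edge_of (job_list S))) B))"
proof -
  have iff: "sum (cap S) B \<le> card (two_jobs S B) \<longleftrightarrow> (\<Sum>i\<in>B. min (cap S i) (njobs S + 1)) \<le> card (two_jobs S B)"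
    if "B \<subseteq> {1..nmach S}" for B
  proof
    have le: "(\<Sum>i\<in>B. min (cap S i) (njobs S + 1)) \<le> sum (cap S) B" by (intro sum_mono) simp
    then show "sum (cap S) B \<le> card (two_jobs S B) \<Longrightarrow> (\<Sum>i\<in>B. min (cap S i) (njobs S + 1)) \<le> card (two_jobs S B)"
      by linarith
    assume small: "(\<Sum>i\<in>B. min (cap S i) (njobs S + 1)) \<le> card (two_jobs S B)"
    have "card (two_jobs S B) \<le> card (jobs S)" by (intro card_mono) (auto simp: two_jobs_def)
    then have J: "card (two_jobs S B) \<le> njobs S" by (simp add: jobs_def)
    have "cap S i = min (cap S i) (njobs S + 1)" if "i \<in> B" for i
    proof -
      have "min (cap S i) (njobs S + 1) \<le> (\<Sum>i\<in>B. min (cap S i) (njobs S + 1))"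
        using that \<open>B \<subseteq> {1..nmach S}\<close> by (intro member_le_sum) (auto intro: finite_subset)
      then show ?thesis using small J by linarith
    qed
    then show "sum (cap S) B \<le> card (two_jobs S B)" using small by simp
  qed
  have "overcrowded S B \<longleftrightarrow> B \<subseteq> {1..nmach S} \<and> B \<noteq> {} \<and>
      (\<Sum>i\<in>B. min (cap S i) (njobs S + 1)) \<le> card (two_jobs S B)" for B
    unfolding overcrowded_def machines_def using iff[of B] by (rule conj_cong[OF refl conj_cong[OF refl]])
  then show ?thesis
    by (simp only: card_two_jobs[OF assms] length_job_list)
qed

lemma program_decides_reachable_deadlock:
  assumes wf: "well_formed S" and two: "\<And>j. j \<in> jobs S \<Longrightarrow> card (req S j) \<le> 2"
  shows "dec (step_bound (nmach S) (njobs S)) 0 (\<lambda>_. 0) (encode S) (reachable_deadlock S)"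
proof -
  let ?es = "concat (map edge_of (job_list S))"
  have fin: "finite (req S j)" and req: "req S j \<subseteq> {1..nmach S}" if "j \<in> jobs S" for j
    using wf that finite_subset[of "req S j" "machines S"] by (auto simp: well_formed_def machines_def)
  have ls: "length l \<le> 2 \<and> set l \<subseteq> {1..nmach S}" if l: "l \<in> set (job_list S)" for l
  proof -
    obtain j where j: "j \<in> jobs S" "l = sorted_list_of_set (req S j)"
      using l by (auto simp: set_job_list)
    then show ?thesis using two[OF j(1)] fin[OF j(1)] req[OF j(1)] by simp
  qed
  have es: "fst (?es ! e) \<in> {1..nmach S} \<and> snd (?es ! e) \<in> {1..nmach S} \<and> fst (?es ! e) \<noteq> snd (?es ! e)"
    if "e < length ?es" for e
  proof -
    have "?es ! e \<in> set ?es" using that by (rule nth_mem)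
    then obtain j where j: "j \<in> jobs S" "?es ! e \<in> set (edge_of (sorted_list_of_set (req S j)))"
      by (auto simp: set_job_list)
    show ?thesis using edge_of_sorted(1)[OF fin[OF j(1)] j(2)] req[OF j(1)] by blast
  qed
  note answer = trans[OF reachable_deadlock_iff_overcrowded[OF wf two] overcrowded_iff_truncated[OF fin]]
  have "dec (step_bound (nmach S) (length (job_list S))) 0 (\<lambda>_. 0) (encode S) (reachable_deadlock S)"
    unfolding encode_eq by (rule program_decides_density[OF ls es answer])
  then show ?thesis by simp
qed

section \<open>The polynomial bound\<close>

text \<open>Every job writes at least the number of its machines. So the number of jobs, though
  given in binary, is at most the length of the input.\<close>

lemma length_encode_jobs: "length ls \<le> length (concat (map encode_job ls))"
  by (induction ls) (auto simp: encode_job_def)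

lemma step_bound_mono: "n \<le> N \<Longrightarrow> J \<le> N \<Longrightarrow> step_bound n J \<le> step_bound N N"
  unfolding step_bound_def by (intro add_mono mult_mono power_mono order_refl le0) auto

lemma length_le_input_size: "length xs \<le> input_size xs"
  by (induction xs) (auto simp: input_size_def int_size_def)

lemma int_size_le: "int_size x \<le> 1 + nat \<bar>x\<bar>"
  using floorlog_leI[of "nat \<bar>x\<bar>" 2 "nat \<bar>x\<bar>"] by (simp add: int_size_def)

lemma int_size_le_input_size: "x \<in> set xs \<Longrightarrow> int_size x \<le> input_size xs"
  unfolding input_size_def by (rule member_le_sum_list) simp_all

theorem theorem7p3:
  "polynomial_time_solvable encode
     {S :: open_shop. well_formed S \<and> (\<forall>j\<in>jobs S. card (req S j) \<le> 2)}
     reachable_deadlock"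
proof -
  let ?X = "[:0, 1:] :: nat poly"
  define T where "T = 30 * (?X * (?X * ?X * (?X + 1))\<^sup>2 * (?X + 1) + ?X) + (6 * ?X + 7) + 1 + 18 * ?X + 1 + 3 +
     (5 * ?X + 20) * ?X + 1 + 3 + 3 * ?X + 1 + 6"
  have T: "poly T N = step_bound N N" for N
    by (simp add: T_def step_bound_def algebra_simps)
  have "\<exists>t \<le> poly (2 * T * (?X + 21 + T)) (input_size (encode S)). halts prog (start (encode S)) t (reachable_deadlock S)"
    if S: "well_formed S" "\<forall>j\<in>jobs S. card (req S j) \<le> 2" for S
  proof -
    let ?N = "input_size (encode S)"
    have len: "length (encode S) \<ge> nmach S" "length (encode S) \<ge> njobs S"
      using length_encode_jobs[of "job_list S"] by (simp_all add: encode_eq del: upt_Suc)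
    then have "step_bound (nmach S) (njobs S) \<le> step_bound ?N ?N"
      using length_le_input_size[of "encode S"] by (intro step_bound_mono) linarith+
    then have "decides prog (step_bound ?N ?N) 0 (\<lambda>_. 0) (encode S) (reachable_deadlock S)"
      using program_decides_reachable_deadlock[OF S(1)] S(2) dec_mono unfolding dec_def by blast
    \<comment> \<open>Constants of the program are at most 20 in absolute value and so have size at
      most 21.\<close>
    moreover have "int_size x \<le> ?N + 21" if "Const i x \<in> set prog" for i x
    proof -
      have "nat \<bar>x\<bar> \<le> 20" using that by (auto simp: prog_def)
      then show ?thesis using int_size_le[of x] by linarith
    qed
    ultimately have "\<exists>t \<le> 2 * step_bound ?N ?N * (?N + 21 + step_bound ?N ?N).
        halts prog \<lparr>pc = 0, regs = (\<lambda>_. 0), input = encode S\<rparr> t (reachable_deadlock S)"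
      by (intro decides_halts) (use int_size_le[of 0] in \<open>auto simp: trans_le_add1 int_size_le_input_size\<close>)
    then show ?thesis by (simp add: start_def T)
  qed
  then show ?thesis unfolding polynomial_time_solvable_def by blast
qed

end
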